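(* Let $G$ be a finite group which is a weak direct product $G=[A]B$ of subgroups $A$ and $B$ (with $A$ normal in $G$). If $A$ and $B$ are supersoluble, then $G$ is supersoluble.
   Context: All groups are finite. Two subgroups $X,Y$ of a group permute if $XY=YX$. Let $G=AB$ be a product of subgroups $A$ and $B$. $G$ is a weak normal product of $A$ and $B$ if (a) $A$ is normal in $G$, and (b) $B$ permutes with every maximal subgroup of every Sylow subgroup of $A$ (for all primes). $G$ is a weak direct product of $A$ and $B$, written $G=[A]B$, if $G=AB$ is a weak normal product of $A$ and $B$ with $A$ normal in $G$ and $A\cap B=1$. *)

theory Defs
  imports "HOL-Algebra.Elementary_Groups" "HOL-Computational_Algebra.Primes"
begin

text \<open>Subgroups are subsets of the carrier; a subgroup \<open>H\<close> of \<open>G\<close> is regarded as a group in its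
  own right through the record \<open>G\<lparr>carrier := H\<rparr>\<close>.\<close>

definition supersoluble :: "('a, 'b) monoid_scheme \<Rightarrow> bool" where
  "supersoluble G \<longleftrightarrow> group G \<and>
     (\<exists>(n::nat) N. N 0 = {\<one>\<^bsub>G\<^esub>} \<and> N n = carrier G \<and>
        (\<forall>i\<le>n. N i \<lhd> G) \<and>
        (\<forall>i<n. N i \<subseteq> N (Suc i) \<and> cyclic_group ((G\<lparr>carrier := N (Suc i)\<rparr>) Mod N i)))"

definition maximal_subgroup :: "'a set \<Rightarrow> ('a, 'b) monoid_scheme \<Rightarrow> bool" where
  "maximal_subgroup M G \<longleftrightarrow> subgroup M G \<and> M \<noteq> carrier G \<and>
     (\<forall>K. subgroup K G \<and> M \<subseteq> K \<longrightarrow> K = M \<or> K = carrier G)"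

text \<open>Only meaningful for finite \<open>G\<close>. If \<open>p\<close> does not divide the order of \<open>G\<close>, the Sylow
  \<open>p\<close>-subgroup is trivial and has no maximal subgroup.\<close>

definition sylow_subgroup :: "nat \<Rightarrow> 'a set \<Rightarrow> ('a, 'b) monoid_scheme \<Rightarrow> bool" where
  "sylow_subgroup p P G \<longleftrightarrow>
     Factorial_Ring.prime p \<and> subgroup P G \<and> card P = p ^ multiplicity p (order G)"

definition permutes_with :: "('a, 'b) monoid_scheme \<Rightarrow> 'a set \<Rightarrow> 'a set \<Rightarrow> bool" where
  "permutes_with G X Y \<longleftrightarrow> X <#>\<^bsub>G\<^esub> Y = Y <#>\<^bsub>G\<^esub> X"

definition weak_normal_product ::
    "('a, 'b) monoid_scheme \<Rightarrow> 'a set \<Rightarrow> 'a set \<Rightarrow> bool" where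
  "weak_normal_product G A B \<longleftrightarrow>
     subgroup A G \<and> subgroup B G \<and> carrier G = A <#>\<^bsub>G\<^esub> B \<and>
     A \<lhd> G \<and>
     (\<forall>p P M. sylow_subgroup p P (G\<lparr>carrier := A\<rparr>) \<and> maximal_subgroup M (G\<lparr>carrier := P\<rparr>)
        \<longrightarrow> permutes_with G B M)"

definition weak_direct_product ::
    "('a, 'b) monoid_scheme \<Rightarrow> 'a set \<Rightarrow> 'a set \<Rightarrow> bool" where
  "weak_direct_product G A B \<longleftrightarrow> weak_normal_product G A B \<and> A \<inter> B = {\<one>\<^bsub>G\<^esub>}"

end

theory Submission
  imports
    Defs
    "HOL-Algebra.Sylow"
    "HOL-Algebra.Group_Action"
    "HOL-Number_Theory.Residues"
    "HOL-Computational_Algebra.Polynomial"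
begin

text \<open>
  The complement \<open>B\<close> normalizes every maximal subgroup \<open>M\<close> of every Sylow subgroup of \<open>A\<close>: if
  \<open>b x = m b'\<close> with \<open>x\<close>, \<open>m\<close> in \<open>M\<close> and \<open>b\<close>, \<open>b'\<close> in \<open>B\<close>, then \<open>b' b\<^sup>-\<^sup>1\<close> lies in \<open>A \<inter> B = 1\<close>, so
  \<open>b x b\<^sup>-\<^sup>1 = m\<close>. Permutability enters only in this form. A chain of normal subgroups of \<open>G\<close> with factors of prime
  order is built, first from \<open>1\<close> to \<open>A\<close> and then from \<open>A\<close> to \<open>G\<close>. The second half is easy: if \<open>S < T\<close> are
  consecutive members of such a chain of \<open>B\<close>, then \<open>A S < A T\<close> are normal in \<open>G\<close> with the same index.

  For the first half, let \<open>N < A\<close> be normal in \<open>G\<close> and let \<open>p\<close> be the largest prime divisor of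
  \<open>|A/N|\<close>. Since \<open>A\<close> is supersoluble, \<open>A/N\<close> has a normal Sylow \<open>p\<close>-subgroup \<open>P\<close>
  (\<open>p_elements_mod_subgroup\<close>), which is normal in \<open>G/N\<close> and is the image of a Sylow subgroup of
  \<open>A\<close>; so the image of \<open>B\<close> normalizes every subgroup of index \<open>p\<close> of \<open>P\<close>. It remains to find in \<open>P\<close>
  a subgroup of order \<open>p\<close> that is normal in \<open>G/N\<close> (\<open>ex_normal_prime_order_subgroup\<close>). Write
  \<open>G\<close> for \<open>G/N\<close>, let \<open>\<Phi>\<close> be the intersection of the subgroups of index \<open>p\<close> of \<open>P\<close>, and let \<open>K\<close> be
  the kernel of the action of \<open>G\<close> on \<open>P/\<Phi>\<close>.

  \<^item> A linear map that leaves every hyperplane invariant is a scalar. So each \<open>b\<close> in \<open>B\<close> acts on \<open>P/\<Phi>\<close>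
    as \<open>x \<mapsto> x\<^sup>k\<close> with one exponent \<open>k\<close> (\<open>p_group_power_map\<close>), and \<open>b\<^sup>p\<^sup>-\<^sup>1\<close> as well as all
    commutators of \<open>b\<close> with elements of \<open>G\<close> lie in \<open>K\<close>.
  \<^item> \<open>K\<close> acts on \<open>P\<close> as a \<open>p\<close>-group, because a subgroup of \<open>K\<close> of order prime to \<open>p\<close> fixes a point in
    every coset of \<open>\<Phi>\<close> (\<open>coprime_subgroup_centralizes\<close>). Hence \<open>K\<close>, which contains \<open>P\<close>, centralizes
    a nontrivial subgroup of exponent \<open>p\<close> of \<open>P\<close> that is normal in \<open>G\<close>; let \<open>W\<close> be a minimal normal
    subgroup of \<open>G\<close> inside it.
  \<^item> On \<open>W\<close>, conjugation by \<open>b\<close> commutes with the action of \<open>G\<close> and has order dividing \<open>p - 1\<close>. As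
    \<open>X\<^sup>p\<^sup>-\<^sup>1 - 1\<close> is a product of linear factors modulo \<open>p\<close>, there is an eigenvector
    (\<open>ex_eigenvector\<close>). The eigenspace is normal in \<open>G\<close>, so it is all of \<open>W\<close>, and \<open>b\<close> acts on \<open>W\<close> as
    a power map.
  \<^item> Therefore every subgroup of \<open>W\<close> is invariant under \<open>B\<close>. Supersolubility of \<open>A\<close> gives one of prime
    order that is invariant under \<open>A\<close>, and this one is normal in \<open>G = A B\<close>.

  Supersolubility of \<open>A\<close> and \<open>B\<close> enters only through \<open>prime_chief\<close>, a refinement property which,
  unlike a given chain, can be applied directly between any two invariant subgroups.
\<close>

section \<open>Counting moved points\<close>

text \<open>The orbit-stabilizer theorem for an action given as a plain function, so that an action need not be
  presented as a homomorphism into the group of bijections of \<open>E\<close>.\<close>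

lemma (in group) card_orbit_mult_card_stabilizer:
  fixes act :: "'a \<Rightarrow> 'x \<Rightarrow> 'x"
  assumes closed: "\<And>g x. g \<in> carrier G \<Longrightarrow> x \<in> E \<Longrightarrow> act g x \<in> E"
    and one: "\<And>x. x \<in> E \<Longrightarrow> act \<one> x = x"
    and mult: "\<And>g h x. g \<in> carrier G \<Longrightarrow> h \<in> carrier G \<Longrightarrow> x \<in> E \<Longrightarrow> act (g \<otimes> h) x = act g (act h x)"
    and x: "x \<in> E"
  shows "card ((\<lambda>g. act g x) ` carrier G) * card {g \<in> carrier G. act g x = x} = Coset.order G"
proof -
  let ?f = "\<lambda>g. restrict (act g) E"
  have bij: "bij_betw (act g) E E" if g: "g \<in> carrier G" for g
  proof (rule bij_betw_byWitness[where f' = "act (inv g)"])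
    show "\<forall>a\<in>E. act (inv g) (act g a) = a"
      using g mult[of "inv g" g] one by simp
    show "\<forall>a\<in>E. act g (act (inv g) a) = a"
      using g mult[of g "inv g"] one by simp
  qed (use closed g in auto)
  have "group_hom G (BijGroup E) ?f"
  proof (intro group_hom.intro group_hom_axioms.intro homI)
    show "group G" "group (BijGroup E)"
      by (rule is_group, rule group_BijGroup)
    show Bij: "?f g \<in> carrier (BijGroup E)" if "g \<in> carrier G" for g
      using bij[OF that] by (auto simp: BijGroup_def Bij_def bij_betw_def inj_on_def)
    show "?f (g \<otimes> h) = ?f g \<otimes>\<^bsub>BijGroup E\<^esub> ?f h" if "g \<in> carrier G" "h \<in> carrier G" for g h
      using Bij[OF that(1)] Bij[OF that(2)] that mult closed
      by (auto simp: BijGroup_def compose_def fun_eq_iff)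
  qed
  then interpret group_action G E ?f
    by (rule group_action.intro)
  have "orbit G ?f x = (\<lambda>g. act g x) ` carrier G" "stabilizer G ?f x = {g \<in> carrier G. act g x = x}"
    using x by (auto simp: orbit_def stabilizer_def)
  then show ?thesis
    using orbit_stabilizer_theorem[OF x] by simp
qed

text \<open>The moved points are the union of the orbits with more than one element. The length of such an
  orbit has a prime divisor, and this can only be \<open>q\<close>. The hypothesis concerns orbit lengths and not
  the order of the group because in \<open>p_dvd_card_fixed_points\<close> only the group induced on \<open>E\<close> is a
  \<open>q\<close>-group.\<close>

lemma (in group) prime_dvd_card_moved_points:
  fixes act :: "'a \<Rightarrow> 'x \<Rightarrow> 'x"
  assumes fin: "finite E"
    and closed: "\<And>g x. g \<in> carrier G \<Longrightarrow> x \<in> E \<Longrightarrow> act g x \<in> E"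
    and one: "\<And>x. x \<in> E \<Longrightarrow> act \<one> x = x"
    and mult: "\<And>g h x. g \<in> carrier G \<Longrightarrow> h \<in> carrier G \<Longrightarrow> x \<in> E \<Longrightarrow> act (g \<otimes> h) x = act g (act h x)"
    and sizes: "\<And>x r. x \<in> E \<Longrightarrow> Factorial_Ring.prime r \<Longrightarrow> r dvd card ((\<lambda>g. act g x) ` carrier G) \<Longrightarrow> r = q"
  shows "q dvd card {x \<in> E. \<exists>g\<in>carrier G. act g x \<noteq> x}"
proof -
  let ?M = "{x \<in> E. \<exists>g\<in>carrier G. act g x \<noteq> x}"
  let ?O = "\<lambda>x. (\<lambda>g. act g x) ` carrier G"
  have undo: "act (inv g) (act g x) = x" if "g \<in> carrier G" "x \<in> E" for g x
    using that mult[of "inv g" g x] one by simp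
  have sub: "?O x \<subseteq> ?O y" if xyz: "x \<in> E" "y \<in> E" "z \<in> ?O x" "z \<in> ?O y" for x y z
  proof -
    obtain g h where g: "g \<in> carrier G" "z = act g x" and h: "h \<in> carrier G" "z = act h y"
      using xyz(3,4) by blast
    have x: "x = act (inv g \<otimes> h) y"
      using undo[OF g(1) that(1)] g h that mult[of "inv g" h y] by simp
    show ?thesis
    proof
      fix w assume "w \<in> ?O x"
      then obtain k where k: "k \<in> carrier G" "w = act k x" by auto
      then have "w = act (k \<otimes> (inv g \<otimes> h)) y"
        using mult[of k "inv g \<otimes> h" y] x g h that by simp
      then show "w \<in> ?O y" using k g h by blast
    qed
  qed
  have self: "x \<in> ?O x" if "x \<in> E" for x
    using one[OF that] by (metis image_eqI one_closed)
  have moved: "?O x \<subseteq> ?M" if x: "x \<in> ?M" for x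
  proof
    fix y assume "y \<in> ?O x"
    then obtain g where g: "g \<in> carrier G" "y = act g x" by auto
    have "\<exists>h\<in>carrier G. act h y \<noteq> y"
    proof (rule ccontr)
      assume c: "\<not> ?thesis"
      have "x = y" using undo[of g x] g x c by auto
      then show False using c x by auto
    qed
    then show "y \<in> ?M" using g x closed by auto
  qed
  have U: "\<Union>(?O ` ?M) = ?M"
    using moved self by blast
  have "q dvd card (\<Union>(?O ` ?M))"
  proof (rule dvd_partition)
    show "finite (\<Union>(?O ` ?M))" unfolding U using fin by simp
    show "\<forall>c\<in>?O ` ?M. q dvd card c"
    proof
      fix c assume "c \<in> ?O ` ?M"
      then obtain x where x: "x \<in> ?M" "c = ?O x" by blast
      then obtain g where g: "g \<in> carrier G" "act g x \<noteq> x" by blast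
      have "x \<in> c" "act g x \<in> c" using x g self by auto
      then have "card c \<noteq> 1" using g(2) by (metis card_1_singletonE singletonD)
      then obtain r where "Factorial_Ring.prime r" "r dvd card c"
        using prime_factor_nat by blast
      then show "q dvd card c" using sizes[of x r] x by auto
    qed
    show "\<forall>c1\<in>?O ` ?M. \<forall>c2\<in>?O ` ?M. c1 \<noteq> c2 \<longrightarrow> c1 \<inter> c2 = {}"
    proof (intro ballI impI, rule ccontr)
      fix c1 c2 assume "c1 \<in> ?O ` ?M" "c2 \<in> ?O ` ?M" and ne: "c1 \<noteq> c2" and "c1 \<inter> c2 \<noteq> {}"
      then obtain x y z where "x \<in> ?M" "y \<in> ?M" "c1 = ?O x" "c2 = ?O y" "z \<in> c1" "z \<in> c2"
        by blast
      then show False using sub[of x y z] sub[of y x z] ne by auto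
    qed
  qed
  then show ?thesis unfolding U .
qed

lemma (in group) p_group_dvd_card_moved_points:
  fixes act :: "'a \<Rightarrow> 'x \<Rightarrow> 'x"
  assumes p: "Factorial_Ring.prime p" and ord: "Coset.order G = p ^ n"
    and fin: "finite E"
    and closed: "\<And>g x. g \<in> carrier G \<Longrightarrow> x \<in> E \<Longrightarrow> act g x \<in> E"
    and one: "\<And>x. x \<in> E \<Longrightarrow> act \<one> x = x"
    and mult: "\<And>g h x. g \<in> carrier G \<Longrightarrow> h \<in> carrier G \<Longrightarrow> x \<in> E \<Longrightarrow> act (g \<otimes> h) x = act g (act h x)"
  shows "p dvd card {x \<in> E. \<exists>g\<in>carrier G. act g x \<noteq> x}"
proof (rule prime_dvd_card_moved_points[OF fin closed one mult])
  fix x r assume x: "x \<in> E" and r: "Factorial_Ring.prime r" "r dvd card ((\<lambda>g. act g x) ` carrier G)"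
  have "r dvd p ^ n"
    using card_orbit_mult_card_stabilizer[of E act x, OF closed one mult x] r(2) ord
      dvd_mult2[OF r(2), of "card {g \<in> carrier G. act g x = x}"] by simp
  then show "r = p"
    using r(1) p prime_dvd_power primes_dvd_imp_eq by blast
qed

section \<open>Preimages in quotient groups\<close>

text \<open>A subgroup \<open>S\<close> of \<open>G/H\<close> is a set of cosets, so its preimage in \<open>G\<close> is simply \<open>\<Union>S\<close>.\<close>

lemma (in normal) mem_Union_subgroup_Mod:
  assumes S: "subgroup S (G Mod H)" and x: "x \<in> carrier G"
  shows "x \<in> \<Union>S \<longleftrightarrow> H #> x \<in> S"
proof
  assume "x \<in> \<Union>S"
  then obtain C where C: "C \<in> S" "x \<in> C" by blast
  then have "C \<in> rcosets H" using subgroup.subset[OF S] by (auto simp: FactGroup_def)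
  then obtain y where "y \<in> carrier G" "C = H #> y" by (auto simp: RCOSETS_def)
  then show "H #> x \<in> S"
    using C repr_independence[of x H y] subgroup_axioms by auto
next
  assume "H #> x \<in> S"
  then show "x \<in> \<Union>S" using rcos_self[OF x subgroup_axioms] by blast
qed

lemma (in normal) card_Union_subgroup_Mod:
  assumes fin: "finite (carrier G)" and S: "subgroup S (G Mod H)"
  shows "card (\<Union>S) = card H * card S"
proof -
  have S': "S \<subseteq> rcosets H" using subgroup.subset[OF S] by (auto simp: FactGroup_def)
  have "card H * card S = card (\<Union>S)"
  proof (rule card_partition)
    show "finite S"
      using S' fin rcosets_finite finite_subset subset
      by (metis finite_Pow_iff rcosets_subset_PowG subgroup_axioms)
    have "\<Union>S \<subseteq> carrier G" using S' rcosets_part_G[OF subgroup_axioms] by blast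
    then show "finite (\<Union>S)" using fin finite_subset by blast
    show "card c = card H" if "c \<in> S" for c
      using that S' card_rcosets_equal[of c H] subset by (metis subsetD)
    show "c1 \<inter> c2 = {}" if "c1 \<in> S" "c2 \<in> S" "c1 \<noteq> c2" for c1 c2
      using rcos_disjoint[OF subgroup_axioms] that S' unfolding pairwise_def disjnt_def by blast
  qed
  then show ?thesis by simp
qed

lemma (in group) cauchy:
  assumes "finite (carrier G)" "Factorial_Ring.prime p" "p dvd Coset.order G"
  obtains S where "subgroup S G" "card S = p"
proof -
  have "Coset.order G = p ^ 1 * (Coset.order G div p)" using assms(3) by simp
  then obtain S where "subgroup S G" "card S = p ^ 1"
    using sylow_thm[OF assms(2) is_group _ assms(1)] by blast
  then show thesis using that by simp
qed

section \<open>Subgroups of index p in p-groups\<close>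

text \<open>\<open>H\<close> acts on its right cosets by multiplication, and the number of cosets is divisible by \<open>p\<close>.
  The coset \<open>H\<close> is fixed, so there is another fixed coset; that \<open>H #> x\<close> is fixed says that \<open>x\<close>
  normalizes \<open>H\<close>.\<close>

lemma (in group) p_group_normalizer_grows:
  assumes p: "Factorial_Ring.prime p" and ord: "Coset.order G = p ^ n"
    and H: "subgroup H G" "H \<noteq> carrier G"
  obtains x where "x \<in> carrier G" "x \<notin> H" "\<forall>h\<in>H. x \<otimes> h \<otimes> inv x \<in> H"
proof -
  interpret H: subgroup H G by fact
  interpret HH: group "G\<lparr>carrier := H\<rparr>" by (rule H.subgroup_is_group[OF is_group])
  have fin: "finite (carrier G)"
    using ord p order_gt_0_iff_finite prime_gt_0_nat by (metis zero_less_power)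
  let ?E = "rcosets H"
  let ?act = "\<lambda>h C. C #> inv h"
  let ?M = "{C \<in> ?E. \<exists>h\<in>carrier (G\<lparr>carrier := H\<rparr>). ?act h C \<noteq> C}"
  have lag: "card ?E * card H = p ^ n" using lagrange[OF H(1)] ord by simp
  have finE: "finite ?E"
    by (metis fin finite_Pow_iff finite_subset rcosets_subset_PowG H(1))
  obtain m where m: "card H = p ^ m"
    using lag p by (metis divides_primepow_nat dvd_triv_right)
  have "card ?E \<noteq> 1"
  proof
    assume "card ?E = 1"
    then have "card H = card (carrier G)" using lag ord by (simp add: Coset.order_def)
    then show False using H fin card_subset_eq[OF fin H.subset] by simp
  qed
  moreover have "card ?E dvd p ^ n" using lag by (metis dvd_triv_left)
  ultimately have pE: "p dvd card ?E"
    using p by (metis divides_primepow_nat dvd_power neq0_conv power_0)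
  have "p dvd card ?M"
  proof (rule HH.p_group_dvd_card_moved_points[OF p _ finE, of m])
    show "Coset.order (G\<lparr>carrier := H\<rparr>) = p ^ m" using m by (simp add: Coset.order_def)
    show "?act g C \<in> ?E" if "g \<in> carrier (G\<lparr>carrier := H\<rparr>)" "C \<in> ?E" for g C
      using that by (auto simp: RCOSETS_def) (metis H.mem_carrier H.subset coset_mult_assoc inv_closed m_closed)
    show "?act \<one>\<^bsub>G\<lparr>carrier := H\<rparr>\<^esub> C = C" if "C \<in> ?E" for C
      using that H.rcosets_carrier[OF is_group] by simp
    show "?act (g \<otimes>\<^bsub>G\<lparr>carrier := H\<rparr>\<^esub> h) C = ?act g (?act h C)"
      if "g \<in> carrier (G\<lparr>carrier := H\<rparr>)" "h \<in> carrier (G\<lparr>carrier := H\<rparr>)" "C \<in> ?E" for g h C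
      using that H.rcosets_carrier[OF is_group] by (simp add: inv_mult_group coset_mult_assoc)
  qed
  then have "p dvd card (?E - ?M)"
    using pE finE by (metis (no_types, lifting) card_Diff_subset dvd_diff_nat finite_subset mem_Collect_eq subsetI)
  moreover have "H \<in> ?E - ?M"
    using H.subgroup_in_rcosets[OF is_group] coset_join2 H(1) H.m_inv_closed by auto
  moreover have "p \<noteq> 1" using p by auto
  ultimately have "?E - ?M \<noteq> {H}" "H \<in> ?E - ?M" by auto
  then obtain C where C: "C \<in> ?E - ?M" "C \<noteq> H" by blast
  then obtain x where x: "x \<in> carrier G" "C = H #> x" by (auto simp: RCOSETS_def)
  show thesis
  proof
    show "x \<in> carrier G" by fact
    show "x \<notin> H" using x C coset_join2[of x H] H by auto
    show "\<forall>h\<in>H. x \<otimes> h \<otimes> inv x \<in> H"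
    proof
      fix h assume h: "h \<in> H"
      have "\<forall>k\<in>H. C #> inv k = C" using C(1) by simp
      then have "C #> inv (inv h) = C" using H.m_inv_closed[OF h] by (rule bspec)
      then have "H #> x #> inv (inv h) = H #> x" unfolding x(2) .
      then have "H #> (x \<otimes> h) = H #> x"
        using h x H.subset by (simp add: coset_mult_assoc)
      then have "x \<otimes> h \<in> H #> x"
        using rcos_self[of "x \<otimes> h" H] H(1) h x by auto
      then show "x \<otimes> h \<otimes> inv x \<in> H"
        using x h H.rcos_module_imp[OF is_group, of x "x \<otimes> h"] by auto
    qed
  qed
qed

section \<open>Conjugation\<close>

definition conj_by :: "('a, 'b) monoid_scheme \<Rightarrow> 'a \<Rightarrow> 'a \<Rightarrow> 'a" where
  "conj_by G a x = a \<otimes>\<^bsub>G\<^esub> x \<otimes>\<^bsub>G\<^esub> inv\<^bsub>G\<^esub> a"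

definition normalizes :: "('a, 'b) monoid_scheme \<Rightarrow> 'a set \<Rightarrow> 'a set \<Rightarrow> bool" where
  "normalizes G A N \<longleftrightarrow> (\<forall>a\<in>A. \<forall>x\<in>N. conj_by G a x \<in> N)"

context group begin

lemma conj_by_closed [simp, intro]: "a \<in> carrier G \<Longrightarrow> x \<in> carrier G \<Longrightarrow> conj_by G a x \<in> carrier G"
  by (simp add: conj_by_def)

lemma conj_by_one_right [simp]: "a \<in> carrier G \<Longrightarrow> conj_by G a \<one> = \<one>"
  by (simp add: conj_by_def)

lemma conj_by_one_left [simp]: "x \<in> carrier G \<Longrightarrow> conj_by G \<one> x = x"
  by (simp add: conj_by_def)

lemma conj_by_mult_right:
  "a \<in> carrier G \<Longrightarrow> x \<in> carrier G \<Longrightarrow> y \<in> carrier G \<Longrightarrow>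
    conj_by G a (x \<otimes> y) = conj_by G a x \<otimes> conj_by G a y"
  using m_assoc[of "inv a" a "y \<otimes> inv a"] by (simp add: conj_by_def m_assoc)

lemma conj_by_mult_left:
  "a \<in> carrier G \<Longrightarrow> b \<in> carrier G \<Longrightarrow> x \<in> carrier G \<Longrightarrow>
    conj_by G (a \<otimes> b) x = conj_by G a (conj_by G b x)"
  by (simp add: conj_by_def m_assoc inv_mult_group)

lemma conj_by_hom: "a \<in> carrier G \<Longrightarrow> conj_by G a \<in> hom G G"
  by (auto intro!: homI simp: conj_by_mult_right)

lemma conj_by_group_hom: "a \<in> carrier G \<Longrightarrow> group_hom G G (conj_by G a)"
  by (intro group_hom.intro group_hom_axioms.intro is_group conj_by_hom)

lemma conj_by_inv_right:
  "a \<in> carrier G \<Longrightarrow> x \<in> carrier G \<Longrightarrow> conj_by G a (inv x) = inv (conj_by G a x)"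
  using group_hom.hom_inv[OF conj_by_group_hom] .

lemma conj_by_nat_pow:
  "a \<in> carrier G \<Longrightarrow> x \<in> carrier G \<Longrightarrow> conj_by G a (x [^] (n::nat)) = conj_by G a x [^] n"
  using group_hom.hom_nat_pow[OF conj_by_group_hom] .

lemma conj_by_inv_left [simp]:
  assumes "a \<in> carrier G" "x \<in> carrier G"
  shows "conj_by G (inv a) (conj_by G a x) = x" "conj_by G a (conj_by G (inv a) x) = x"
  using assms conj_by_mult_left[of "inv a" a x] conj_by_mult_left[of a "inv a" x] by auto

lemma conj_by_eq_iff:
  assumes "a \<in> carrier G" "x \<in> carrier G" "y \<in> carrier G"
  shows "conj_by G a x = y \<longleftrightarrow> a \<otimes> x = y \<otimes> a"
  unfolding conj_by_def using assms inv_solve_right'[of "a \<otimes> x" a y] by (metis inv_solve_right m_closed)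

lemma conj_by_inj: "a \<in> carrier G \<Longrightarrow> S \<subseteq> carrier G \<Longrightarrow> inj_on (conj_by G a) S"
  by (rule inj_on_inverseI[where g = "conj_by G (inv a)"]) auto

lemma normalizesD: "normalizes G A N \<Longrightarrow> a \<in> A \<Longrightarrow> x \<in> N \<Longrightarrow> conj_by G a x \<in> N"
  by (simp add: normalizes_def)

lemma normal_iff_normalizes: "N \<lhd> G \<longleftrightarrow> subgroup N G \<and> normalizes G (carrier G) N"
  by (simp add: normal_inv_iff normalizes_def conj_by_def)

lemma conj_by_image_finite:
  assumes "finite N" "N \<subseteq> carrier G" "a \<in> carrier G" "\<And>x. x \<in> N \<Longrightarrow> conj_by G a x \<in> N"
  shows "conj_by G a ` N = N"
  using assms by (intro card_subset_eq card_image conj_by_inj) auto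

lemma conj_by_inv_closed:
  assumes "finite N" "N \<subseteq> carrier G" "a \<in> carrier G" "\<And>x. x \<in> N \<Longrightarrow> conj_by G a x \<in> N" "x \<in> N"
  shows "conj_by G (inv a) x \<in> N"
proof -
  have "x \<in> conj_by G a ` N" using conj_by_image_finite[OF assms(1-4)] assms(5) by simp
  then show ?thesis using assms(2,3) by auto
qed

text \<open>Invariance of \<open>N\<close> under conjugation by \<open>a\<close> is an inclusion; it passes to \<open>inv a\<close> because \<open>N\<close> is
  finite.\<close>

lemma subgroup_normalizer:
  assumes fin: "finite (carrier G)" and N: "N \<subseteq> carrier G"
  shows "subgroup {a \<in> carrier G. \<forall>x\<in>N. conj_by G a x \<in> N} G"
proof (rule subgroupI)
  show "{a \<in> carrier G. \<forall>x\<in>N. conj_by G a x \<in> N} \<noteq> {}"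
    using N by (auto intro!: exI[of _ \<one>] simp: subset_iff)
next
  fix a assume "a \<in> {a \<in> carrier G. \<forall>x\<in>N. conj_by G a x \<in> N}"
  then show "inv a \<in> {a \<in> carrier G. \<forall>x\<in>N. conj_by G a x \<in> N}"
    using conj_by_inv_closed[OF finite_subset[OF N fin] N] by auto
next
  fix a b assume "a \<in> {a \<in> carrier G. \<forall>x\<in>N. conj_by G a x \<in> N}" "b \<in> {a \<in> carrier G. \<forall>x\<in>N. conj_by G a x \<in> N}"
  then show "a \<otimes> b \<in> {a \<in> carrier G. \<forall>x\<in>N. conj_by G a x \<in> N}"
    using N by (auto simp: conj_by_mult_left subset_iff)
qed auto

end

section \<open>Cosets of a normal subgroup as congruences\<close>

lemma (in normal) rcos_eq_iff:
  assumes "x \<in> carrier G" "y \<in> carrier G"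
  shows "H #> x = H #> y \<longleftrightarrow> x \<otimes> inv y \<in> H"
proof -
  have "H #> x = H #> y \<longleftrightarrow> x \<in> H #> y"
    using assms repr_independence[of x H y] rcos_self[of x H] subgroup_axioms by auto
  then show ?thesis using rcos_module[OF is_group assms(2,1)] by simp
qed

lemma (in normal) rcos_conj:
  assumes "g \<in> carrier G" "x \<in> carrier G" "y \<in> carrier G" "H #> x = H #> y"
  shows "H #> conj_by G g x = H #> conj_by G g y"
proof -
  have "conj_by G g (x \<otimes> inv y) \<in> H"
    using assms rcos_eq_iff normal_axioms by (simp add: normal_iff_normalizes normalizes_def)
  then show ?thesis
    using assms by (simp add: rcos_eq_iff conj_by_mult_right conj_by_inv_right)
qed

lemma (in group) rcos_eq_mono:
  assumes "I \<lhd> G" "M \<lhd> G" "I \<subseteq> M" "x \<in> carrier G" "y \<in> carrier G" "I #> x = I #> y"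
  shows "M #> x = M #> y"
  using assms normal.rcos_eq_iff[of I G x y] normal.rcos_eq_iff[of M G x y] by auto

lemma (in normal) rcos_nat_pow_cong:
  assumes "x \<in> carrier G" "y \<in> carrier G" "H #> x = H #> y"
  shows "H #> (x [^] (k::nat)) = H #> (y [^] k)"
  using FactGroup_pow[OF assms(1), of k] FactGroup_pow[OF assms(2), of k] assms(3) by simp

lemma (in normal) prime_power_in_imp_ord:
  assumes "z \<in> carrier G" "z \<notin> H" "Factorial_Ring.prime p" "z [^] (p::nat) \<in> H"
  shows "group.ord (G Mod H) (H #> z) = p"
proof -
  interpret Q: group "G Mod H" by (rule factorgroup_is_group)
  have c: "H #> z \<in> carrier (G Mod H)" using assms(1) by (auto simp: carrier_FactGroup)
  have "(H #> z) [^]\<^bsub>G Mod H\<^esub> p = \<one>\<^bsub>G Mod H\<^esub>"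
    using assms coset_join2[of "z [^] p" H] subgroup_axioms by (simp add: FactGroup_pow)
  then have "Q.ord (H #> z) dvd p" using Q.pow_eq_id[OF c] by simp
  moreover have "Q.ord (H #> z) \<noteq> 1"
    using Q.ord_eq_1[OF c] assms(1,2) rcos_self[of z H] subgroup_axioms by auto
  ultimately show ?thesis using assms(3) by (metis prime_nat_iff)
qed

text \<open>Adjoining to \<open>H\<close> an element \<open>z\<close> of order \<open>p\<close> modulo \<open>H\<close>: \<open>L\<close> is the preimage of the cyclic subgroup
  that \<open>z\<close> generates in the quotient. The description of its elements by cosets is what lets \<open>L\<close> be
  compared with other subgroups.\<close>

lemma (in normal) cyclic_extension:
  assumes fin: "finite (carrier G)"
    and z: "z \<in> carrier G" "z \<notin> H" and p: "Factorial_Ring.prime p" "z [^] (p::nat) \<in> H"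
  obtains L where "subgroup L G" "H \<subseteq> L" "card L = card H * p"
    "\<forall>y\<in>carrier G. y \<in> L \<longleftrightarrow> (\<exists>j::nat. H #> y = H #> (z [^] j))"
proof -
  interpret Q: group "G Mod H" by (rule factorgroup_is_group)
  have c: "H #> z \<in> carrier (G Mod H)" using z by (auto simp: carrier_FactGroup)
  have finQ: "finite (carrier (G Mod H))" using fin by (simp add: carrier_FactGroup)
  let ?S = "generate (G Mod H) {H #> z}"
  have S: "subgroup ?S (G Mod H)" using Q.generate_is_subgroup c by simp
  have S_eq: "?S = {(H #> z) [^]\<^bsub>G Mod H\<^esub> k | k::nat. k \<in> UNIV}"
    using Q.generate_pow_nat[OF c] Q.ord_ge_1[OF finQ c] by (simp add: not_less_eq_eq)
  have card: "card ?S = p"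
    using Q.generate_pow_card[OF c] prime_power_in_imp_ord[OF z p] by simp
  have mem: "y \<in> \<Union>?S \<longleftrightarrow> (\<exists>j::nat. H #> y = H #> (z [^] j))" if "y \<in> carrier G" for y
    unfolding mem_Union_subgroup_Mod[OF S that] using z by (auto simp: S_eq FactGroup_pow)
  show thesis
  proof
    show "subgroup (\<Union>?S) G" using factgroup_subgroup_union_subgroup[OF S] by simp
    show "card (\<Union>?S) = card H * p" using card_Union_subgroup_Mod[OF fin S] card by simp
    show "H \<subseteq> \<Union>?S" using subgroup.one_closed[OF S] by auto
  qed (use mem in blast)
qed

text \<open>Take a maximal proper subgroup \<open>M\<close> above \<open>H\<close>. It is normal because normalizers grow. By Cauchy's
  theorem \<open>G/M\<close> has a subgroup of order \<open>p\<close>, whose preimage can only be \<open>G\<close>.\<close>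

lemma (in group) p_group_subgroup_in_index_p:
  assumes p: "Factorial_Ring.prime p" and ord: "Coset.order G = p ^ n"
    and H: "subgroup H G" "H \<noteq> carrier G"
  obtains M where "M \<lhd> G" "H \<subseteq> M" "card M * p = Coset.order G"
proof -
  have fin: "finite (carrier G)"
    using ord p order_gt_0_iff_finite prime_gt_0_nat by (metis zero_less_power)
  define F where "F = {M. subgroup M G \<and> H \<subseteq> M \<and> M \<noteq> carrier G}"
  have "finite F"
    by (rule finite_subset[of _ "Pow (carrier G)"]) (use fin in \<open>auto simp: F_def dest: subgroup.subset\<close>)
  moreover have "F \<noteq> {}" using H by (auto simp: F_def)
  ultimately have "\<exists>M\<in>F. \<forall>L\<in>F. M \<subseteq> L \<longrightarrow> M = L"
    by (rule finite_has_maximal)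
  then obtain M where M: "M \<in> F" "\<forall>L\<in>F. M \<subseteq> L \<longrightarrow> M = L" by (rule bexE)
  then have sM: "subgroup M G" "M \<subseteq> carrier G" "M \<noteq> carrier G" "H \<subseteq> M"
    by (auto simp: F_def dest: subgroup.subset)
  have maximal: "L = carrier G" if "subgroup L G" "M \<subseteq> L" "M \<noteq> L" for L
    using M(2) that sM(4) by (auto simp: F_def)
  define N where "N = {a \<in> carrier G. \<forall>x\<in>M. conj_by G a x \<in> M}"
  have sN: "subgroup N G" unfolding N_def by (rule subgroup_normalizer[OF fin sM(2)])
  have MN: "M \<subseteq> N"
    using sM(2) subgroup.m_closed[OF sM(1)] subgroup.m_inv_closed[OF sM(1)] by (auto simp: conj_by_def N_def)
  obtain x where x: "x \<in> carrier G" "x \<notin> M" "\<forall>h\<in>M. x \<otimes> h \<otimes> inv x \<in> M"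
    using p_group_normalizer_grows[OF p ord sM(1,3)] .
  then have "x \<in> N" by (simp add: conj_by_def N_def)
  then have "N = carrier G" using maximal[OF sN MN] x(2) by auto
  then have "M \<lhd> G" using sM(1) by (auto simp: normal_iff_normalizes normalizes_def N_def)
  then interpret M: normal M G .
  interpret Q: group "G Mod M" by (rule M.factorgroup_is_group)
  have lag: "Coset.order (G Mod M) * card M = p ^ n"
    using lagrange[OF sM(1)] ord by (simp add: Coset.order_def FactGroup_def)
  have finQ: "finite (carrier (G Mod M))" using fin by (simp add: carrier_FactGroup)
  have "Coset.order (G Mod M) \<noteq> 1"
  proof
    assume "Coset.order (G Mod M) = 1"
    then have "card M = card (carrier G)" using lag ord by (simp add: Coset.order_def)
    then show False using sM card_subset_eq[OF fin sM(2)] by simp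
  qed
  moreover have "Coset.order (G Mod M) dvd p ^ n" using lag by (metis dvd_triv_left)
  ultimately have "p dvd Coset.order (G Mod M)"
    using p by (metis divides_primepow_nat dvd_power neq0_conv power_0)
  then obtain S where S: "subgroup S (G Mod M)" "card S = p"
    using Q.cauchy[OF finQ p] by blast
  have U: "subgroup (\<Union>S) G" "M \<subseteq> \<Union>S" "card (\<Union>S) = card M * p"
    using M.factgroup_subgroup_union_subgroup[OF S(1)] subgroup.one_closed[OF S(1)]
      M.card_Union_subgroup_Mod[OF fin S(1)] S(2) by auto
  moreover have "card M > 0" using fin sM by (simp add: subgroup.finite_imp_card_positive)
  moreover have "1 < p" using p prime_gt_1_nat by blast
  ultimately have "\<Union>S \<noteq> M" by auto
  then have "\<Union>S = carrier G" using maximal[OF U(1,2)] by simp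
  then show thesis using that[OF \<open>M \<lhd> G\<close> sM(4)] U(3) by (simp add: Coset.order_def)
qed

lemma (in group) p_group_index_p_normal:
  assumes p: "Factorial_Ring.prime p" and ord: "Coset.order G = p ^ n"
    and M: "subgroup M G" "card M * p = Coset.order G"
  shows "M \<lhd> G"
proof -
  have fin: "finite (carrier G)"
    using ord p order_gt_0_iff_finite prime_gt_0_nat by (metis zero_less_power)
  have p1: "p > 1" using p prime_gt_1_nat by blast
  have "card M > 0" using fin M by (simp add: subgroup.finite_imp_card_positive)
  then have "M \<noteq> carrier G" using M(2) p1 by (auto simp: Coset.order_def)
  then obtain M' where M': "M' \<lhd> G" "M \<subseteq> M'" "card M' * p = Coset.order G"
    by (rule p_group_subgroup_in_index_p[OF p ord M(1)])
  have "finite M'" using fin subgroup.subset[OF normal_imp_subgroup[OF M'(1)]] finite_subset by metis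
  moreover have "card M * p = card M' * p" using M' M(2) by simp
  then have "card M = card M'" using p1 by simp
  ultimately have "M = M'" using M'(2) by (intro card_subset_eq)
  then show ?thesis using M' by simp
qed

section \<open>Automorphisms that leave every subgroup of index p invariant\<close>

lemma (in normal) index_prime_pow_in:
  assumes p: "Factorial_Ring.prime p" and ind: "card H * p = Coset.order G" and fin: "finite (carrier G)"
    and x: "x \<in> carrier G"
  shows "x [^] p \<in> H"
proof -
  interpret Q: group "G Mod H" by (rule factorgroup_is_group)
  have "Coset.order (G Mod H) * card H = Coset.order G"
    using lagrange[OF subgroup_axioms] by (simp add: Coset.order_def FactGroup_def)
  moreover have "card H > 0" using fin finite_imp_card_positive by simp
  ultimately have "Coset.order (G Mod H) * card H = p * card H" "card H > 0" using ind by (simp_all add: mult.commute)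
  then have "Coset.order (G Mod H) = p" by simp
  then have "(H #> x) [^]\<^bsub>G Mod H\<^esub> p = \<one>\<^bsub>G Mod H\<^esub>"
    using Q.pow_order_eq_1[of "H #> x"] x by (auto simp: carrier_FactGroup)
  then have "H #> (x [^] p) = H" using x by (simp add: FactGroup_pow)
  then show ?thesis using rcos_self[of "x [^] p" H] x subgroup_axioms by auto
qed

text \<open>The quotient has prime order, so it is generated by any nontrivial coset.\<close>

lemma (in normal) index_prime_cover:
  assumes p: "Factorial_Ring.prime p" and ind: "card H * p = Coset.order G" and fin: "finite (carrier G)"
    and x: "x \<in> carrier G" "x \<notin> H" and y: "y \<in> carrier G"
  obtains j :: nat where "H #> y = H #> (x [^] j)"
proof -
  obtain L where L: "subgroup L G" "H \<subseteq> L" "card L = card H * p"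
    "\<forall>y\<in>carrier G. y \<in> L \<longleftrightarrow> (\<exists>j::nat. H #> y = H #> (x [^] j))"
    using cyclic_extension[OF fin x p index_prime_pow_in[OF p ind fin x(1)]] .
  have "L = carrier G"
    using L(1,3) ind fin by (intro card_subset_eq) (auto simp: Coset.order_def dest: subgroup.subset)
  then show thesis using L(4) y that by blast
qed

text \<open>On a cyclic quotient an endomorphism is a power map, whose exponent can be read off at one
  generator.\<close>

lemma (in normal) index_prime_power_map:
  assumes p: "Factorial_Ring.prime p" and ind: "card H * p = Coset.order G" and fin: "finite (carrier G)"
    and T: "T \<in> hom G G" "T ` H \<subseteq> H"
    and z: "z \<in> carrier G" "z \<notin> H" "H #> T z = H #> (z [^] (k::nat))"
    and x: "x \<in> carrier G"
  shows "H #> T x = H #> (x [^] k)"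
proof -
  interpret T: group_hom G G T
    by (intro group_hom.intro group_hom_axioms.intro is_group T(1))
  obtain j :: nat where j: "H #> x = H #> (z [^] j)"
    using index_prime_cover[OF p ind fin z(1,2) x] .
  have "T (x \<otimes> inv (z [^] j)) \<in> H"
    using j rcos_eq_iff[of x "z [^] j"] x z T(2) by auto
  then have "H #> T x = H #> (T z [^] j)"
    using x z by (simp add: rcos_eq_iff T.hom_nat_pow)
  also have "\<dots> = H #> ((z [^] k) [^] j)"
    using z by (intro rcos_nat_pow_cong) auto
  also have "\<dots> = H #> ((z [^] j) [^] k)"
    using z by (simp add: nat_pow_pow mult.commute)
  also have "\<dots> = H #> (x [^] k)"
    using z x j by (intro rcos_nat_pow_cong) auto
  finally show ?thesis .
qed

lemma (in normal) rcos_pow_eq_iff_cong: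
  assumes "z \<in> carrier G" "z \<notin> H" "Factorial_Ring.prime p" "z [^] (p::nat) \<in> H"
  shows "H #> (z [^] (i::nat)) = H #> (z [^] (j::nat)) \<longleftrightarrow> [int i = int j] (mod int p)"
proof -
  interpret Q: group "G Mod H" by (rule factorgroup_is_group)
  have c: "H #> z \<in> carrier (G Mod H)" using assms(1) by (auto simp: carrier_FactGroup)
  have "H #> (z [^] i) = H #> (z [^] j) \<longleftrightarrow> (H #> z) [^]\<^bsub>G Mod H\<^esub> int i = (H #> z) [^]\<^bsub>G Mod H\<^esub> int j"
    using assms(1) by (simp add: int_pow_int FactGroup_pow)
  also have "\<dots> \<longleftrightarrow> int p dvd int j - int i"
    using Q.int_pow_eq[OF c] prime_power_in_imp_ord[OF assms] by simp
  also have "\<dots> \<longleftrightarrow> [int i = int j] (mod int p)"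
    using dvd_diff_commute[of "int p" "int i" "int j"] by (simp add: cong_iff_dvd_diff)
  finally show ?thesis .
qed

text \<open>The group-theoretic form of the fact that a linear map leaving every hyperplane invariant is a
  scalar. For one subgroup \<open>N\<close> of index \<open>p\<close> the exponent \<open>k\<close> comes from the cyclic quotient. For another
  one, \<open>M\<close>, choose \<open>z\<close> outside of both. The subgroup \<open>L\<close> generated by \<open>z\<close> and \<open>M \<inter> N\<close> has index
  \<open>p\<close> too, so \<open>T z\<close> is \<open>z\<^sup>j\<close> modulo \<open>M \<inter> N\<close> for a single \<open>j\<close>. Modulo \<open>N\<close> this forces
  \<open>j = k\<close> up to multiples of \<open>p\<close>, hence \<open>T z\<close> is \<open>z\<^sup>k\<close> modulo \<open>M\<close>.\<close>

lemma (in group) p_group_power_map: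
  assumes p: "Factorial_Ring.prime p" and ord: "Coset.order G = p ^ n"
    and T: "T \<in> hom G G"
    and TM: "\<And>M. subgroup M G \<Longrightarrow> card M * p = Coset.order G \<Longrightarrow> T ` M \<subseteq> M"
  obtains k :: nat where
    "\<And>M x. subgroup M G \<Longrightarrow> card M * p = Coset.order G \<Longrightarrow> x \<in> carrier G \<Longrightarrow> M #> T x = M #> (x [^] k)"
proof (cases "\<exists>M. subgroup M G \<and> card M * p = Coset.order G")
  case False
  show thesis by (rule that[of 0]) (use False in blast)
next
  case True
  have fin: "finite (carrier G)"
    using ord p order_gt_0_iff_finite prime_gt_0_nat by (metis zero_less_power)
  have p1: "p > 1" using p prime_gt_1_nat by blast
  have Tc: "T x \<in> carrier G" if "x \<in> carrier G" for x using T that by (auto simp: hom_def)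
  obtain N where N: "subgroup N G" "card N * p = Coset.order G" using True by blast
  then interpret N: normal N G using p_group_index_p_normal[OF p ord] by blast
  have proper: "M \<noteq> carrier G" if "subgroup M G" "card M * p = Coset.order G" for M
    using that subgroup.finite_imp_card_positive[OF that(1) fin] p1 by (auto simp: Coset.order_def)
  then obtain z0 where z0: "z0 \<in> carrier G" "z0 \<notin> N" using N N.subset by blast
  obtain k :: nat where k0: "N #> T z0 = N #> (z0 [^] k)"
    using N.index_prime_cover[OF p N(2) fin z0 Tc[OF z0(1)]] .
  have kN: "N #> T x = N #> (x [^] k)" if "x \<in> carrier G" for x
    using N.index_prime_power_map[OF p N(2) fin T TM[OF N] z0 k0 that] .
  have main: "M #> T x = M #> (x [^] k)"
    if M: "subgroup M G" "card M * p = Coset.order G" and x: "x \<in> carrier G" for M x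
  proof (cases "M = N")
    case True
    then show ?thesis using kN x by simp
  next
    case False
    interpret M: normal M G using p_group_index_p_normal[OF p ord M] .
    interpret I: normal "M \<inter> N" G
      by (rule normal_subgroup_intersect[OF M.normal_axioms N.normal_axioms])
    have "card M * p = card N * p" using M(2) N(2) by simp
    then have cMN: "card M = card N" using p1 by simp
    have "finite M" "finite N" using fin M.subset N.subset finite_subset by auto
    then have "\<not> M \<subseteq> N" "\<not> N \<subseteq> M"
      using cMN False card_subset_eq[of N M] card_subset_eq[of M N] by auto
    then obtain u v where u: "u \<in> N" "u \<notin> M" and v: "v \<in> M" "v \<notin> N" by blast
    let ?z = "u \<otimes> v"
    have zc: "?z \<in> carrier G" using u v by simp
    have zM: "?z \<notin> M"
    proof
      assume "?z \<in> M"
      then have "?z \<otimes> inv v \<in> M" using v by simp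
      then show False using u v by (simp add: m_assoc)
    qed
    have zN: "?z \<notin> N"
    proof
      assume "?z \<in> N"
      then have "inv u \<otimes> ?z \<in> N" using u by simp
      then show False using u v by (simp flip: m_assoc)
    qed
    have powN: "w [^] p \<in> N" "w [^] p \<in> M" if "w \<in> carrier G" for w
      using N.index_prime_pow_in[OF p N(2) fin that] M.index_prime_pow_in[OF p M(2) fin that] by auto
    have zI: "?z \<notin> M \<inter> N" "?z [^] p \<in> M \<inter> N" using zM powN[OF zc] by auto
    obtain L where L: "subgroup L G" "M \<inter> N \<subseteq> L" "card L = card (M \<inter> N) * p"
      "\<forall>y\<in>carrier G. y \<in> L \<longleftrightarrow> (\<exists>j::nat. (M \<inter> N) #> y = (M \<inter> N) #> (?z [^] j))"
      using I.cyclic_extension[OF fin zc zI(1) p zI(2)] .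
    have uc: "u \<in> carrier G" using u by simp
    have uI: "u \<notin> M \<inter> N" "u [^] p \<in> M \<inter> N" using u powN[OF uc] by auto
    \<comment> \<open>That \<open>L\<close> has index \<open>p\<close> is seen by comparing it with \<open>N\<close>, which arises in the same way
      from \<open>M \<inter> N\<close> and the element \<open>u\<close>.\<close>
    obtain L' where L': "subgroup L' G" "M \<inter> N \<subseteq> L'" "card L' = card (M \<inter> N) * p"
      "\<forall>y\<in>carrier G. y \<in> L' \<longleftrightarrow> (\<exists>j::nat. (M \<inter> N) #> y = (M \<inter> N) #> (u [^] j))"
      using I.cyclic_extension[OF fin uc uI(1) p uI(2)] .
    have "y \<in> L' \<longleftrightarrow> y \<in> N" if y: "y \<in> carrier G" for y
    proof
      assume "y \<in> L'"
      then obtain j :: nat where "(M \<inter> N) #> y = (M \<inter> N) #> (u [^] j)" using L'(4) y by blast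
      then have "y \<otimes> inv (u [^] j) \<in> N" using I.rcos_eq_iff y uc by auto
      moreover have "u [^] j \<in> N" using u(1) by (induction j) auto
      ultimately have "y \<otimes> inv (u [^] j) \<otimes> (u [^] j) \<in> N" by blast
      then show "y \<in> N" using y uc by (simp add: m_assoc)
    next
      assume yN: "y \<in> N"
      obtain j :: nat where "M #> y = M #> (u [^] j)"
        using M.index_prime_cover[OF p M(2) fin uc u(2) y] .
      then have "y \<otimes> inv (u [^] j) \<in> M" using M.rcos_eq_iff y uc by auto
      moreover have "u [^] j \<in> N" using u(1) by (induction j) auto
      ultimately have "y \<otimes> inv (u [^] j) \<in> M \<inter> N" using yN by auto
      then show "y \<in> L'" using bspec[OF L'(4) y] I.rcos_eq_iff y uc by auto
    qed
    then have "L' = N" using subgroup.subset[OF L'(1)] N.subset by blast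
    then have Lp: "card L * p = Coset.order G" using L(3) L'(3) N(2) by simp
    have "?z \<in> L" using bspec[OF L(4) zc] zc by (metis nat_pow_eone)
    then have "T ?z \<in> L" using TM[OF L(1) Lp] by blast
    then obtain j :: nat where j: "(M \<inter> N) #> T ?z = (M \<inter> N) #> (?z [^] j)"
      using L(4) Tc[OF zc] by blast
    have jN: "N #> T ?z = N #> (?z [^] j)" and jM: "M #> T ?z = M #> (?z [^] j)"
      by (rule rcos_eq_mono[OF I.normal_axioms _ _ _ _ j];
          use zc Tc N.normal_axioms M.normal_axioms in auto)+
    have "[int j = int k] (mod int p)"
      using N.rcos_pow_eq_iff_cong[OF zc zN p powN(1)[OF zc]] jN kN[OF zc] by metis
    then have "M #> T ?z = M #> (?z [^] k)"
      using M.rcos_pow_eq_iff_cong[OF zc zM p powN(2)[OF zc]] jM by metis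
    then show ?thesis using M.index_prime_power_map[OF p M(2) fin T TM[OF M] zc zM _ x] by simp
  qed
  show thesis by (rule that[of k]) (rule main)
qed

section \<open>Eigenvectors of automorphisms of order dividing p - 1\<close>

text \<open>Lagrange's bound on the number of roots, over the integers modulo \<open>p\<close>: divide by \<open>X - a\<close> and use
  that the other roots stay roots of the quotient. Divisibility of all coefficients is written as
  divisibility by a constant polynomial.\<close>

lemma const_dvd_poly_if_many_roots:
  fixes f :: "int poly"
  assumes p: "Factorial_Ring.prime p" and S: "finite S"
    and roots: "\<And>a. a \<in> S \<Longrightarrow> p dvd poly f a"
    and distinct: "\<And>a b. a \<in> S \<Longrightarrow> b \<in> S \<Longrightarrow> p dvd b - a \<Longrightarrow> a = b"
    and deg: "degree f < card S"
  shows "[:p:] dvd f"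
  using S roots distinct deg
proof (induction S arbitrary: f rule: finite_induct)
  case empty
  then show ?case by simp
next
  case (insert a S)
  let ?g = "synthetic_div f a"
  have f: "f = [:- a, 1:] * ?g + [:poly f a:]" using synthetic_div_correct'[of a f] by simp
  have c: "[:p:] dvd [:poly f a:]" using insert.prems(1)[of a] by (auto simp: const_poly_dvd_iff coeff_pCons split: nat.split)
  have "[:p:] dvd ?g"
  proof (cases "degree f = 0")
    case True
    then have "?g = 0" by (simp add: synthetic_div_eq_0_iff)
    then show ?thesis by simp
  next
    case False
    show ?thesis
    proof (rule insert.IH)
      fix b assume b: "b \<in> S"
      have "poly f b = (b - a) * poly ?g b + poly f a"
        by (subst f) (simp add: algebra_simps)
      moreover have "p dvd poly f b" "p dvd poly f a" using insert.prems(1) b by auto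
      ultimately have "p dvd (b - a) * poly ?g b" by (simp add: dvd_add_left_iff)
      moreover have "\<not> p dvd b - a" using insert.prems(2)[of a b] b insert.hyps by auto
      ultimately show "p dvd poly ?g b" using p prime_dvd_mult_iff by blast
    next
      show "degree ?g < card S" using insert False by (simp add: degree_synthetic_div)
    qed (use insert.prems in auto)
  qed
  then have "[:p:] dvd [:- a, 1:] * ?g + [:poly f a:]" using c by (intro dvd_add dvd_mult)
  then show ?case using f by simp
qed

text \<open>By Fermat both monic polynomials have the roots \<open>1, \<dots>, p - 1\<close> modulo \<open>p\<close>, so their difference
  has more roots than its degree permits.\<close>

lemma prod_linear_cong_fermat:
  fixes p :: nat
  assumes p: "Factorial_Ring.prime p"
  shows "[:int p:] dvd (\<Prod>k\<in>{1..p - 1}. [:- int k, 1:]) - (monom 1 (p - 1) - 1)" (is "_ dvd ?F - ?M")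
proof -
  have p1: "p - 1 > 0" using p prime_gt_1_nat[of p] by simp
  have degF: "degree ?F = p - 1" by (subst degree_prod_sum_eq) auto
  have lcF: "coeff ?F (p - 1) = 1"
    using lead_coeff_prod[of "\<lambda>k. [:- int k, 1:]" "{1..p - 1}"] degF by simp
  have degM: "degree ?M \<le> p - 1"
    by (intro degree_diff_le) (auto simp: degree_monom_le)
  have "coeff (?F - ?M) (p - 1) = 0" using lcF p1 by simp
  moreover have "degree (?F - ?M) \<le> p - 1" by (rule degree_diff_le[OF _ degM]) (simp only: degF order_refl)
  ultimately have deg: "degree (?F - ?M) < p - 1"
    using p1 by (metis degree_0 le_neq_implies_less leading_coeff_0_iff)
  show ?thesis
  proof (rule const_dvd_poly_if_many_roots[of "int p" "int ` {1..p - 1}"])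
    show "Factorial_Ring.prime (int p)" using p by simp
    show "degree (?F - ?M) < card (int ` {1..p - 1})" using deg by (simp add: card_image)
    fix a assume "a \<in> int ` {1..p - 1}"
    then obtain n where n: "n \<in> {1..p - 1}" "a = int n" by blast
    have "poly ?F a = 0" using n by (auto simp: poly_prod)
    moreover have "int p dvd int n ^ (p - 1) - 1"
    proof -
      have "\<not> p dvd n" using n p1 by (auto dest: dvd_imp_le)
      then have "[n ^ (p - 1) = 1] (mod p)" using fermat_theorem[OF p] by simp
      then have "[int (n ^ (p - 1)) = int 1] (mod int p)" by (simp only: cong_int_iff)
      then show ?thesis by (simp add: cong_iff_dvd_diff)
    qed
    ultimately show "int p dvd poly (?F - ?M) a"
      using n(2) by (simp add: poly_monom dvd_diff_commute)
  next
    fix a b assume "a \<in> int ` {1..p - 1}" "b \<in> int ` {1..p - 1}" "int p dvd b - a"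
    then show "a = b"
      using p1 zdvd_imp_le[of "int p" "b - a"] zdvd_imp_le[of "int p" "a - b"] dvd_diff_commute[of "int p" a b]
      by (cases a b rule: linorder_cases) auto
  qed simp
qed

text \<open>The value at \<open>u\<close> of the endomorphism \<open>f(T)\<close>, computed by Horner's scheme, with the group
  written multiplicatively. Integer coefficients make sense in every abelian group, so no vector space
  over the field with \<open>p\<close> elements has to be constructed.\<close>

definition poly_act :: "('a, 'b) monoid_scheme \<Rightarrow> ('a \<Rightarrow> 'a) \<Rightarrow> int poly \<Rightarrow> 'a \<Rightarrow> 'a" where
  "poly_act G T f u = fold_coeffs (\<lambda>a w. u [^]\<^bsub>G\<^esub> a \<otimes>\<^bsub>G\<^esub> T w) f \<one>\<^bsub>G\<^esub>"

locale comm_group_endo = comm_group G for G (structure) +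
  fixes T assumes T: "T \<in> hom G G"
begin

sublocale T: group_hom G G T
  by (intro group_hom.intro group_hom_axioms.intro is_group T)

lemma poly_act_0 [simp]: "poly_act G T 0 u = \<one>"
  by (simp add: poly_act_def)

lemma poly_act_pCons [simp]:
  "u \<in> carrier G \<Longrightarrow> poly_act G T (pCons a f) u = u [^] a \<otimes> T (poly_act G T f u)"
  by (cases "a = 0 \<and> f = 0") (auto simp: poly_act_def)

lemma poly_act_closed [simp, intro]: "u \<in> carrier G \<Longrightarrow> poly_act G T f u \<in> carrier G"
  by (induction f) auto

lemma poly_act_add:
  assumes "u \<in> carrier G"
  shows "poly_act G T (f + g) u = poly_act G T f u \<otimes> poly_act G T g u"
proof (induction f g rule: poly_induct2)
  case (pCons a f b g)
  then show ?case using assms by (simp add: int_pow_mult m_ac)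
qed simp

lemma poly_act_smult:
  assumes "u \<in> carrier G"
  shows "poly_act G T (smult c f) u = poly_act G T f u [^] c"
proof (induction f)
  case (pCons a f)
  then show ?case
    using assms by (simp add: int_pow_distrib int_pow_pow T.hom_int_pow mult.commute)
qed simp

lemma poly_act_mult:
  assumes "u \<in> carrier G"
  shows "poly_act G T (f * g) u = poly_act G T f (poly_act G T g u)"
proof (induction f)
  case (pCons a f)
  then show ?case using assms by (simp add: poly_act_add poly_act_smult)
qed simp

lemma poly_act_monom:
  assumes "u \<in> carrier G"
  shows "poly_act G T (monom 1 n) u = (T ^^ n) u"
proof (induction n)
  case 0
  then show ?case using assms by (simp add: monom_0)
next
  case (Suc n)
  then have "(T ^^ n) u \<in> carrier G" using poly_act_closed[OF assms, of "monom 1 n"] by simp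
  then show ?case using Suc assms by (simp add: monom_Suc)
qed

text \<open>Apply the factors \<open>T - k\<close> one after the other: the last value before \<open>\<one>\<close> is reached is an
  eigenvector.\<close>

lemma prod_linear_kills_imp_eigenvector:
  assumes "finite K" "u \<in> carrier G" "u \<noteq> \<one>"
    and "poly_act G T (\<Prod>k\<in>K. [:- int k, 1:]) u = \<one>"
  shows "\<exists>k w. w \<in> carrier G \<and> w \<noteq> \<one> \<and> T w = w [^] (k::nat)"
  using assms
proof (induction K arbitrary: u rule: finite_induct)
  case empty
  then show ?case by (simp add: one_pCons)
next
  case (insert k K)
  let ?w = "poly_act G T [:- int k, 1:] u"
  show ?case
  proof (cases "?w = \<one>")
    case True
    then have "u [^] (- int k) \<otimes> T u = \<one>" using insert.prems(1) by simp
    then have "inv (u [^] k) \<otimes> T u = \<one>"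
      using insert.prems(1) by (simp add: int_pow_neg int_pow_int)
    then have "T u = u [^] k"
      using insert.prems(1) by (simp add: inv_solve_left')
    then show ?thesis using insert.prems by blast
  next
    case False
    have "(\<Prod>j\<in>insert k K. [:- int j, 1:]) = (\<Prod>j\<in>K. [:- int j, 1:]) * [:- int k, 1:]"
      using prod.insert[OF insert.hyps(1,2), of "\<lambda>j. [:- int j, 1:]"]
      by (simp only: mult.commute[of "[:- int k, 1:]"])
    then have "poly_act G T (\<Prod>j\<in>K. [:- int j, 1:]) ?w = \<one>"
      using insert.prems(3) poly_act_mult[OF insert.prems(1)] by metis
    then show ?thesis using insert.IH[of ?w] False insert.prems(1) by blast
  qed
qed

text \<open>In exponent \<open>p\<close>, \<open>T\<close> is annihilated by the product of all \<open>T - k\<close> with \<open>k = 1, \<dots>, p - 1\<close>, as this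
  product is \<open>T\<^sup>p\<^sup>-\<^sup>1 - 1\<close> modulo \<open>p\<close>.\<close>

lemma ex_eigenvector:
  assumes p: "Factorial_Ring.prime p"
    and exp: "\<And>x. x \<in> carrier G \<Longrightarrow> x [^] (p::nat) = \<one>"
    and Tp: "\<And>x. x \<in> carrier G \<Longrightarrow> (T ^^ (p - 1)) x = x"
    and u: "u \<in> carrier G" "u \<noteq> \<one>"
  obtains k :: nat and w where "w \<in> carrier G" "w \<noteq> \<one>" "T w = w [^] k"
proof -
  let ?F = "\<Prod>k\<in>{1..p - 1}. [:- int k, 1:]"
  obtain h where "?F - (monom 1 (p - 1) - 1) = [:int p:] * h"
    using prod_linear_cong_fermat[OF p] by (elim dvdE)
  then have F: "?F = [:int p:] * h + (monom 1 (p - 1) + [:-1:])"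
    unfolding diff_eq_eq by (simp add: one_pCons)
  have "poly_act G T ([:int p:] * h) u = \<one>"
    unfolding poly_act_mult[OF u(1)] using u exp by (simp add: int_pow_int)
  then have "poly_act G T ?F u = \<one>"
    unfolding F using u Tp by (simp add: poly_act_add poly_act_monom int_pow_neg)
  then show thesis
    using prod_linear_kills_imp_eigenvector[of "{1..p - 1}" u] u that by blast
qed

end

section \<open>The action on a normal p-subgroup\<close>

lemma (in group) prime_order_cyclic:
  assumes "Factorial_Ring.prime (Coset.order G)"
  shows "cyclic_group G"
proof -
  have fin: "finite (carrier G)"
    using prime_gt_0_nat[OF assms] by (simp add: order_gt_0_iff_finite)
  have "card (carrier G) \<noteq> 1" using assms by (auto simp: Coset.order_def)
  then have "carrier G \<noteq> {\<one>}" by auto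
  then obtain x where x: "x \<in> carrier G" "x \<noteq> \<one>" using one_closed by blast
  then have "ord x \<noteq> 1" using ord_eq_1 by simp
  moreover have "ord x dvd Coset.order G" using ord_dvd_group_order[OF x(1)] .
  ultimately have "ord x = Coset.order G" using assms by (metis prime_nat_iff)
  then have "card (generate G {x}) = card (carrier G)"
    using generate_pow_card[OF x(1)] by (simp add: Coset.order_def)
  then have "generate G {x} = carrier G"
    using generate_incl[of "{x}"] x fin by (intro card_subset_eq) auto
  then show ?thesis
    unfolding cyclic_group using generate_pow[OF x(1)] x(1)
    by (intro bexI[of _ x]) (auto simp: full_SetCompr_eq)
qed

locale normal_p_subgroup = group G for G (structure) +
  fixes p n :: nat and P :: "'a set"
  assumes fin: "finite (carrier G)"
    and prime_p: "Factorial_Ring.prime p"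
    and P_normal: "P \<lhd> G"
    and card_P: "card P = p ^ n"
begin

abbreviation (input) PP where "PP \<equiv> G\<lparr>carrier := P\<rparr>"

definition index_p :: "'a set \<Rightarrow> bool" where
  "index_p M \<longleftrightarrow> subgroup M G \<and> M \<subseteq> P \<and> card M * p = card P"

text \<open>For \<open>P \<noteq> 1\<close> this is the Frattini subgroup of \<open>P\<close>.\<close>

definition frattini :: "'a set" where
  "frattini = {x \<in> P. \<forall>M. index_p M \<longrightarrow> x \<in> M}"

text \<open>The kernel of the action of \<open>G\<close> on \<open>P/frattini\<close> by conjugation.\<close>

definition frattini_kernel :: "'a set" where
  "frattini_kernel = {g \<in> carrier G. \<forall>x\<in>P. conj_by G g x \<otimes> inv x \<in> frattini}"

text \<open>An abelian group of exponent dividing \<open>p\<close> on which \<open>G\<close> acts through \<open>G/frattini_kernel\<close>; it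
  is abelian because \<open>frattini_kernel\<close> contains \<open>P\<close>.\<close>

definition fixed_torsion :: "'a set" where
  "fixed_torsion = {x \<in> P. x [^] p = \<one> \<and> (\<forall>g\<in>frattini_kernel. conj_by G g x = x)}"

lemma P_subgroup: "subgroup P G"
  using P_normal by (rule normal_imp_subgroup)

lemma P_carrier [simp, dest]: "x \<in> P \<Longrightarrow> x \<in> carrier G"
  using P_subgroup by (rule subgroup.mem_carrier)

lemma P_conj [simp, intro]: "g \<in> carrier G \<Longrightarrow> x \<in> P \<Longrightarrow> conj_by G g x \<in> P"
  using P_normal by (simp add: normal_iff_normalizes normalizes_def)

lemma PP_group: "group PP"
  using P_subgroup by (rule subgroup.subgroup_is_group[OF _ is_group])

lemma PP_order: "Coset.order PP = p ^ n"
  by (simp add: Coset.order_def card_P)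

lemma PP_finite: "finite (carrier PP)"
  using fin finite_subset[OF subgroup.subset[OF P_subgroup]] by simp

lemma index_p_iff: "index_p M \<longleftrightarrow> subgroup M PP \<and> card M * p = Coset.order PP"
proof
  assume "index_p M"
  then show "subgroup M PP \<and> card M * p = Coset.order PP"
    using subgroup_incl[OF _ P_subgroup] by (simp add: index_p_def Coset.order_def)
next
  assume *: "subgroup M PP \<and> card M * p = Coset.order PP"
  then have "M \<subseteq> P" using subgroup.subset by fastforce
  with * show "index_p M"
    using incl_subgroup[OF P_subgroup] by (simp add: index_p_def Coset.order_def)
qed

lemma index_p_normal: "index_p M \<Longrightarrow> M \<lhd> PP"
  unfolding index_p_iff using group.p_group_index_p_normal[OF PP_group prime_p PP_order] by blast

lemma index_p_conj:
  assumes M: "index_p M" and g: "g \<in> carrier G"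
  shows "index_p (conj_by G g ` M)"
proof -
  have M': "subgroup M G" "M \<subseteq> P" "card M * p = card P" using M by (auto simp: index_p_def)
  have "subgroup (conj_by G g ` M) G"
    using group_hom.subgroup_img_is_subgroup[OF conj_by_group_hom[OF g] M'(1)] .
  moreover have "card (conj_by G g ` M) = card M"
    using M'(2) g by (intro card_image conj_by_inj) auto
  ultimately show ?thesis using M' g by (auto simp: index_p_def)
qed

text \<open>\<open>P/M\<close> has prime order, so it is abelian.\<close>

lemma index_p_commutator:
  assumes M: "index_p M" and x: "x \<in> P" and y: "y \<in> P"
  shows "conj_by G x y \<otimes> inv y \<in> M"
proof -
  interpret PP: group PP by (rule PP_group)
  interpret M: normal M PP by (rule index_p_normal[OF M])
  interpret Q: group "PP Mod M" by (rule M.factorgroup_is_group)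
  have "Coset.order (PP Mod M) * card M = p * card M"
    using PP.lagrange[of M] M M.subgroup_axioms unfolding index_p_iff
    by (simp add: Coset.order_def FactGroup_def mult.commute)
  moreover have "card M > 0" using M.finite_imp_card_positive PP_finite by simp
  ultimately have "Coset.order (PP Mod M) = p" by simp
  then have "cyclic_group (PP Mod M)" using Q.prime_order_cyclic prime_p by simp
  then interpret Q: comm_group "PP Mod M" by (rule Q.cyclic_imp_abelian_group)
  have c: "M #>\<^bsub>PP\<^esub> x \<in> carrier (PP Mod M)" "M #>\<^bsub>PP\<^esub> y \<in> carrier (PP Mod M)"
    using x y by (auto simp: carrier_FactGroup)
  have "M #>\<^bsub>PP\<^esub> (x \<otimes>\<^bsub>PP\<^esub> y) = M #>\<^bsub>PP\<^esub> (y \<otimes>\<^bsub>PP\<^esub> x)"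
    using Q.m_comm[OF c] x y M.rcos_sum by simp
  then have "(x \<otimes>\<^bsub>PP\<^esub> y) \<otimes>\<^bsub>PP\<^esub> inv\<^bsub>PP\<^esub> (y \<otimes>\<^bsub>PP\<^esub> x) \<in> M"
    using M.rcos_eq_iff[of "x \<otimes>\<^bsub>PP\<^esub> y" "y \<otimes>\<^bsub>PP\<^esub> x"] PP.m_closed x y by simp
  moreover have "inv\<^bsub>PP\<^esub> (y \<otimes> x) = inv (y \<otimes> x)"
    using x y subgroup.m_closed[OF P_subgroup] by (intro m_inv_consistent P_subgroup) auto
  ultimately show ?thesis using x y by (simp add: conj_by_def m_assoc inv_mult_group)
qed

lemma index_p_pow:
  assumes M: "index_p M" and x: "x \<in> P"
  shows "x [^] p \<in> M"
proof -
  interpret PP: group PP by (rule PP_group)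
  interpret M: normal M PP by (rule index_p_normal[OF M])
  have "x [^]\<^bsub>PP\<^esub> p \<in> M"
    using M.index_prime_pow_in[OF prime_p conjunct2[OF M[unfolded index_p_iff]] PP_finite] x by simp
  then show ?thesis by (simp flip: nat_pow_consistent)
qed

lemma frattini_subset: "frattini \<subseteq> P"
  by (auto simp: frattini_def)

lemma frattini_normal: "frattini \<lhd> G"
  unfolding normal_iff_normalizes
proof
  show "subgroup frattini G"
  proof (rule subgroupI)
    show "frattini \<subseteq> carrier G" using frattini_subset by auto
    have "\<one> \<in> frattini"
      using subgroup.one_closed[OF P_subgroup] by (auto simp: frattini_def index_p_def subgroup.one_closed)
    then show "frattini \<noteq> {}" by blast
  qed (use subgroup.m_closed[OF P_subgroup] subgroup.m_inv_closed[OF P_subgroup] in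
      \<open>auto simp: frattini_def index_p_def subgroup.m_closed subgroup.m_inv_closed\<close>)
  show "normalizes G (carrier G) frattini"
    unfolding normalizes_def
  proof (intro ballI)
    fix g x assume g: "g \<in> carrier G" and x: "x \<in> frattini"
    have "conj_by G g x \<in> M" if M: "index_p M" for M
    proof -
      have "x \<in> conj_by G (inv g) ` M"
        using x index_p_conj[OF M, of "inv g"] g by (simp add: frattini_def)
      moreover have "M \<subseteq> carrier G" using M subgroup.subset by (auto simp: index_p_def)
      ultimately show ?thesis using g by auto
    qed
    then show "conj_by G g x \<in> frattini" using x g by (auto simp: frattini_def)
  qed
qed

sublocale Phi: normal frattini G
  by (rule frattini_normal)

lemma frattini_conj: "g \<in> carrier G \<Longrightarrow> x \<in> frattini \<Longrightarrow> conj_by G g x \<in> frattini"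
  using frattini_normal by (simp add: normal_iff_normalizes normalizes_def)

lemma frattini_kernel_iff:
  "g \<in> frattini_kernel \<longleftrightarrow> g \<in> carrier G \<and> (\<forall>x\<in>P. frattini #> conj_by G g x = frattini #> x)"
proof -
  have "conj_by G g x \<otimes> inv x \<in> frattini \<longleftrightarrow> frattini #> conj_by G g x = frattini #> x"
    if "g \<in> carrier G" "x \<in> P" for x
    using Phi.rcos_eq_iff[of "conj_by G g x" x] that by simp
  then show ?thesis unfolding frattini_kernel_def by blast
qed

lemma frattini_kernel_normal: "frattini_kernel \<lhd> G"
  unfolding normal_iff_normalizes
proof
  show "subgroup frattini_kernel G"
  proof (rule subgroupI)
    have "\<one> \<in> frattini_kernel" by (auto simp: frattini_kernel_iff)
    then show "frattini_kernel \<noteq> {}" by blast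
  next
    fix g assume g: "g \<in> frattini_kernel"
    show "inv g \<in> frattini_kernel"
      unfolding frattini_kernel_iff
    proof (intro conjI ballI)
      fix x assume x: "x \<in> P"
      have gc: "g \<in> carrier G" and gP: "\<forall>y\<in>P. frattini #> conj_by G g y = frattini #> y"
        using g by (simp_all add: frattini_kernel_iff)
      have "frattini #> x = frattini #> conj_by G (inv g) x"
        using bspec[OF gP, of "conj_by G (inv g) x"] gc x by simp
      then show "frattini #> conj_by G (inv g) x = frattini #> x" by (rule sym)
    qed (use g in \<open>simp add: frattini_kernel_iff\<close>)
  qed (auto simp: frattini_kernel_iff conj_by_mult_left)
  show "normalizes G (carrier G) frattini_kernel"
    unfolding normalizes_def
  proof (intro ballI)
    fix g k assume g: "g \<in> carrier G" and k: "k \<in> frattini_kernel"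
    then have kc: "k \<in> carrier G" by (simp add: frattini_kernel_iff)
    show "conj_by G g k \<in> frattini_kernel"
      unfolding frattini_kernel_iff
    proof (intro conjI ballI)
      fix x assume x: "x \<in> P"
      have "conj_by G (inv g) x \<in> P" using g x by simp
      then have "frattini #> conj_by G k (conj_by G (inv g) x) = frattini #> conj_by G (inv g) x"
        using k unfolding frattini_kernel_iff by blast
      then have "frattini #> conj_by G g (conj_by G k (conj_by G (inv g) x))
          = frattini #> conj_by G g (conj_by G (inv g) x)"
        using g kc x by (intro Phi.rcos_conj) auto
      moreover have "conj_by G (conj_by G g k) x = conj_by G g (conj_by G k (conj_by G (inv g) x))"
        unfolding conj_by_def[of G g k] using g kc x by (simp add: conj_by_mult_left)
      ultimately show "frattini #> conj_by G (conj_by G g k) x = frattini #> x"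
        using g x by simp
    qed (use g kc in simp)
  qed
qed

lemma P_subset_frattini_kernel: "P \<subseteq> frattini_kernel"
  using index_p_commutator subgroup.m_closed[OF P_subgroup] subgroup.m_inv_closed[OF P_subgroup]
  by (auto simp: frattini_kernel_def frattini_def)

lemma frattini_kernel_subgroup: "subgroup frattini_kernel G"
  using frattini_kernel_normal by (rule normal_imp_subgroup)

text \<open>\<open>Q\<close> acts on each coset of \<open>frattini\<close>. The size of such a coset is a power of \<open>p\<close>, hence not divisible
  by \<open>q\<close>, so \<open>Q\<close> fixes an element of it. Thus the fixed points of \<open>Q\<close> together with \<open>frattini\<close>
  generate \<open>P\<close>. If they formed a proper subgroup, this would lie in a subgroup of index \<open>p\<close>, which also
  contains \<open>frattini\<close>.\<close>

lemma coprime_subgroup_centralizes: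
  assumes q: "Factorial_Ring.prime q" "q \<noteq> p"
    and Q: "subgroup Q G" "Q \<subseteq> frattini_kernel" "card Q = q ^ m"
    and g: "g \<in> Q" and u: "u \<in> P"
  shows "conj_by G g u = u"
proof -
  interpret PP: group PP by (rule PP_group)
  interpret Q: subgroup Q G by (rule Q(1))
  interpret QQ: group "G\<lparr>carrier := Q\<rparr>" by (rule Q.subgroup_is_group[OF is_group])
  let ?C = "{u \<in> P. \<forall>g\<in>Q. conj_by G g u = u}"
  have C: "subgroup ?C G"
    by (rule subgroupI)
      (use subgroup.m_closed[OF P_subgroup] subgroup.m_inv_closed[OF P_subgroup] subgroup.one_closed[OF P_subgroup] in
        \<open>auto simp: conj_by_mult_right conj_by_inv_right intro!: exI[of _ \<one>]\<close>)
  then have C': "subgroup ?C PP" by (rule subgroup_incl[OF _ P_subgroup]) auto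
  have "?C = P"
  proof (rule ccontr)
    assume "?C \<noteq> P"
    then have "?C \<noteq> carrier PP" by simp
    then obtain M where M: "M \<lhd> PP" "?C \<subseteq> M" "card M * p = Coset.order PP"
      by (rule PP.p_group_subgroup_in_index_p[OF prime_p PP_order C'])
    have iM: "index_p M" using M normal_imp_subgroup by (auto simp: index_p_iff)
    then have sM: "subgroup M G" "M \<subseteq> P" by (auto simp: index_p_def)
    have "card M \<noteq> card P"
      using iM prime_gt_1_nat[OF prime_p] card_P by (auto simp: index_p_def)
    then have "M \<noteq> P" by blast
    then obtain u where u: "u \<in> P" "u \<notin> M" using sM(2) by blast
    let ?E = "frattini #> u"
    have Esub: "?E \<subseteq> carrier G" using u by (intro r_coset_subset_G Phi.subset) auto
    have finE: "finite ?E" using Esub fin finite_subset by blast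
    have "card ?E = card frattini"
      using card_rcosets_equal[of ?E frattini] Phi.subset rcosetsI[OF Phi.subset, of u] u by simp
    moreover have "card frattini dvd p ^ n"
      using dvd_triv_right[of "card frattini" "card (rcosets\<^bsub>PP\<^esub> frattini)"]
        PP.lagrange[OF subgroup_incl[OF Phi.subgroup_axioms P_subgroup frattini_subset]] PP_order by simp
    ultimately have qE: "\<not> q dvd card ?E"
      using q prime_p prime_dvd_power[OF q(1), of p n] primes_dvd_imp_eq[OF q(1) prime_p] dvd_trans[of q "card frattini" "p ^ n"]
      by auto
    have mem: "y \<in> ?E \<longleftrightarrow> frattini #> y = ?E" if "y \<in> carrier G" for y
      using that u repr_independence[of y frattini u] rcos_self[of y frattini] Phi.subgroup_axioms by auto
    have EP: "y \<in> P" if y: "y \<in> ?E" for y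
      using y u frattini_subset subgroup.m_closed[OF P_subgroup] by (auto simp: r_coset_def)
    have "q dvd card {x \<in> ?E. \<exists>g\<in>carrier (G\<lparr>carrier := Q\<rparr>). conj_by G g x \<noteq> x}"
    proof (rule QQ.p_group_dvd_card_moved_points[OF q(1) _ finE, of m])
      show "Coset.order (G\<lparr>carrier := Q\<rparr>) = q ^ m" using Q(3) by (simp add: Coset.order_def)
      show "conj_by G g x \<in> ?E" if "g \<in> carrier (G\<lparr>carrier := Q\<rparr>)" "x \<in> ?E" for g x
      proof -
        have g: "g \<in> frattini_kernel" "g \<in> carrier G" using that Q(2) by auto
        have xc: "x \<in> carrier G" using that(2) Esub by blast
        have x: "x \<in> P" "frattini #> x = ?E" using that(2) EP[of x] mem[OF xc] by simp_all
        then have "frattini #> conj_by G g x = ?E" using g by (simp add: frattini_kernel_iff)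
        then show ?thesis using mem[OF conj_by_closed[OF g(2) xc]] by simp
      qed
    qed (use Esub in \<open>auto simp: conj_by_mult_left\<close>)
    then have "{x \<in> ?E. \<exists>g\<in>carrier (G\<lparr>carrier := Q\<rparr>). conj_by G g x \<noteq> x} \<noteq> ?E"
      using qE by metis
    then obtain y where y: "y \<in> ?E" "\<forall>g\<in>Q. conj_by G g y = y" by auto
    then have "y \<in> M" using M(2) EP by auto
    moreover obtain f where f: "f \<in> frattini" "y = f \<otimes> u" using y(1) by (auto simp: r_coset_def)
    moreover have "f \<in> M" using f(1) iM by (auto simp: frattini_def)
    ultimately have "inv f \<otimes> (f \<otimes> u) \<in> M"
      using subgroup.m_closed[OF sM(1)] subgroup.m_inv_closed[OF sM(1)] by auto
    moreover have "f \<in> carrier G" using f(1) frattini_subset by auto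
    ultimately show False using u by (simp flip: m_assoc)
  qed
  then show ?thesis using g u by blast
qed

text \<open>\<open>frattini_kernel\<close> acts on \<open>P\<close> with orbits of \<open>p\<close>-power length: for a prime \<open>r \<noteq> p\<close> its Sylow
  \<open>r\<close>-subgroups act trivially, so every stabilizer contains one.\<close>

lemma p_dvd_card_fixed_points:
  assumes n: "n > 0"
  shows "p dvd card {x \<in> P. \<forall>g\<in>frattini_kernel. conj_by G g x = x}"
proof -
  interpret K: subgroup frattini_kernel G by (rule frattini_kernel_subgroup)
  let ?KK = "G\<lparr>carrier := frattini_kernel\<rparr>"
  interpret KK: group ?KK by (rule K.subgroup_is_group[OF is_group])
  have finK: "finite frattini_kernel" using K.subset fin finite_subset by blast
  have finP: "finite P" using fin finite_subset[OF subgroup.subset[OF P_subgroup]] by blast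
  let ?M = "{x \<in> P. \<exists>g\<in>carrier ?KK. conj_by G g x \<noteq> x}"
  have "p dvd card ?M"
  proof (rule KK.prime_dvd_card_moved_points[OF finP])
    fix x r assume x: "x \<in> P" and r: "Factorial_Ring.prime r" "r dvd card ((\<lambda>g. conj_by G g x) ` carrier ?KK)"
    let ?S = "{g \<in> carrier ?KK. conj_by G g x = x}"
    have os: "card ((\<lambda>g. conj_by G g x) ` carrier ?KK) * card ?S = Coset.order ?KK"
      by (rule KK.card_orbit_mult_card_stabilizer[where E = P])
        (use x in \<open>auto simp: conj_by_mult_left\<close>)
    show "r = p"
    proof (rule ccontr)
      assume rp: "r \<noteq> p"
      let ?m = "multiplicity r (Coset.order ?KK)"
      have "Coset.order ?KK = r ^ ?m * (Coset.order ?KK div r ^ ?m)"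
        by (simp add: multiplicity_dvd)
      then obtain Q where Q: "subgroup Q ?KK" "card Q = r ^ ?m"
        using sylow_thm[OF r(1) KK.is_group, of ?m "Coset.order ?KK div r ^ ?m"] finK by auto
      have Q': "Q \<subseteq> frattini_kernel" using subgroup.subset[OF Q(1)] by simp
      have "subgroup Q G" using incl_subgroup[OF frattini_kernel_subgroup Q(1)] .
      then have QS: "Q \<subseteq> ?S"
        using coprime_subgroup_centralizes[OF r(1) rp _ Q' Q(2)] x Q' by auto
      have S: "subgroup ?S G"
        by (rule subgroupI)
          (use x in \<open>auto simp: conj_by_mult_left intro!: exI[of _ \<one>]\<close>,
           metis K.mem_carrier P_carrier conj_by_inv_left(1))
      then interpret SS: group "G\<lparr>carrier := ?S\<rparr>" by (rule subgroup.subgroup_is_group[OF _ is_group])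
      have "subgroup Q (G\<lparr>carrier := ?S\<rparr>)"
        using subgroup_incl[OF \<open>subgroup Q G\<close> S QS] .
      then have "card Q dvd card ?S"
        using SS.lagrange[of Q] dvd_triv_right[of "card Q" "card (rcosets\<^bsub>G\<lparr>carrier := ?S\<rparr>\<^esub> Q)"] by (simp add: Coset.order_def)
      then have "r * r ^ ?m dvd Coset.order ?KK"
        using mult_dvd_mono[OF r(2), of "card Q" "card ?S"] Q(2) os by simp
      then have "r ^ Suc ?m dvd Coset.order ?KK" by simp
      moreover have "Coset.order ?KK > 0" using finK KK.order_gt_0_iff_finite by simp
      ultimately show False
        using multiplicity_geI[where p = r and n = "Suc ?m" and x = "Coset.order ?KK"] prime_gt_1_nat[OF r(1)] by auto
    qed
  qed (auto simp: conj_by_mult_left)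
  moreover have "p dvd card P" using n card_P by simp
  ultimately have "p dvd card (P - ?M)"
    using finP by (subst card_Diff_subset) (auto intro: dvd_diff_nat)
  moreover have "P - ?M = {x \<in> P. \<forall>g\<in>frattini_kernel. conj_by G g x = x}" by auto
  ultimately show ?thesis by simp
qed

lemma fixed_torsion_commute: "x \<in> fixed_torsion \<Longrightarrow> y \<in> fixed_torsion \<Longrightarrow> x \<otimes> y = y \<otimes> x"
proof -
  assume x: "x \<in> fixed_torsion" and y: "y \<in> fixed_torsion"
  then have "conj_by G x y = y" using P_subset_frattini_kernel by (auto simp: fixed_torsion_def)
  then show ?thesis using x y by (auto simp: fixed_torsion_def conj_by_eq_iff)
qed

lemma fixed_torsion_pow_mult: "x \<in> fixed_torsion \<Longrightarrow> y \<in> fixed_torsion \<Longrightarrow> (x \<otimes> y) [^] (k::nat) = x [^] k \<otimes> y [^] k"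
  by (rule pow_mult_distrib[OF fixed_torsion_commute]) (auto simp: fixed_torsion_def)

lemma fixed_torsion_normal: "fixed_torsion \<lhd> G"
  unfolding normal_iff_normalizes
proof
  show "subgroup fixed_torsion G"
  proof (rule subgroupI)
    have "\<one> \<in> fixed_torsion"
      using subgroup.one_closed[OF P_subgroup] by (auto simp: fixed_torsion_def frattini_kernel_def)
    then show "fixed_torsion \<noteq> {}" by blast
  next
    fix x assume "x \<in> fixed_torsion"
    then show "inv x \<in> fixed_torsion"
      using subgroup.m_inv_closed[OF P_subgroup]
      by (auto simp: fixed_torsion_def nat_pow_inv conj_by_inv_right frattini_kernel_def)
  next
    fix x y assume "x \<in> fixed_torsion" "y \<in> fixed_torsion"
    then show "x \<otimes> y \<in> fixed_torsion"
      using subgroup.m_closed[OF P_subgroup] fixed_torsion_pow_mult[of x y p]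
      by (auto simp: fixed_torsion_def conj_by_mult_right frattini_kernel_def)
  qed (auto simp: fixed_torsion_def)
  show "normalizes G (carrier G) fixed_torsion"
    unfolding normalizes_def
  proof (intro ballI)
    fix g x assume g: "g \<in> carrier G" and x: "x \<in> fixed_torsion"
    have x': "x \<in> P" "x [^] p = \<one>" using x by (auto simp: fixed_torsion_def)
    have "conj_by G k (conj_by G g x) = conj_by G g x" if k: "k \<in> frattini_kernel" for k
    proof -
      have kc: "k \<in> carrier G" using k by (simp add: frattini_kernel_def)
      have "conj_by G (inv g) k \<in> frattini_kernel"
        using frattini_kernel_normal k g by (simp add: normal_iff_normalizes normalizes_def)
      then have "conj_by G g (conj_by G (conj_by G (inv g) k) x) = conj_by G g x"
        using x by (simp add: fixed_torsion_def)
      then show ?thesis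
        unfolding conj_by_def[of G "inv g" k] using g kc x' by (simp add: conj_by_mult_left)
    qed
    then show "conj_by G g x \<in> fixed_torsion"
      using x' g by (simp add: fixed_torsion_def flip: conj_by_nat_pow)
  qed
qed

text \<open>The fixed points of \<open>frattini_kernel\<close> in \<open>P\<close> form a group whose order is divisible by \<open>p\<close>; Cauchy's
  theorem gives elements of order \<open>p\<close>.\<close>

lemma fixed_torsion_nontrivial:
  assumes n: "n > 0"
  shows "fixed_torsion \<noteq> {\<one>}"
proof -
  let ?V = "{x \<in> P. \<forall>g\<in>frattini_kernel. conj_by G g x = x}"
  have V: "subgroup ?V G"
    by (rule subgroupI)
      (use subgroup.m_closed[OF P_subgroup] subgroup.m_inv_closed[OF P_subgroup] subgroup.one_closed[OF P_subgroup] in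
        \<open>auto simp: conj_by_mult_right conj_by_inv_right frattini_kernel_def intro!: exI[of _ \<one>]\<close>)
  interpret VV: group "G\<lparr>carrier := ?V\<rparr>" using V by (rule subgroup.subgroup_is_group[OF _ is_group])
  have "finite ?V" using fin finite_subset[OF subgroup.subset[OF V]] by blast
  then obtain S where S: "subgroup S (G\<lparr>carrier := ?V\<rparr>)" "card S = p"
    using VV.cauchy[OF _ prime_p] p_dvd_card_fixed_points[OF n] by (auto simp: Coset.order_def)
  have SG: "subgroup S G" using incl_subgroup[OF V S(1)] .
  interpret SS: group "G\<lparr>carrier := S\<rparr>" using SG by (rule subgroup.subgroup_is_group[OF _ is_group])
  have "S \<subseteq> fixed_torsion"
  proof
    fix x assume x: "x \<in> S"
    have "x [^]\<^bsub>G\<lparr>carrier := S\<rparr>\<^esub> p = \<one>" using SS.pow_order_eq_1[of x] x S(2) by (simp add: Coset.order_def)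
    then show "x \<in> fixed_torsion"
      using x subgroup.subset[OF S(1)] by (auto simp: fixed_torsion_def simp flip: nat_pow_consistent)
  qed
  moreover have "\<not> S \<subseteq> {\<one>}"
    using S(2) prime_gt_1_nat[OF prime_p] card_mono[of "{\<one>}" S] by auto
  ultimately show ?thesis by blast
qed

text \<open>Congruence modulo every subgroup of index \<open>p\<close> is congruence modulo their intersection.\<close>

lemma power_map_mod_frattini:
  assumes b: "b \<in> carrier G"
    and bM: "\<And>M x. index_p M \<Longrightarrow> x \<in> M \<Longrightarrow> conj_by G b x \<in> M"
  obtains k :: nat where "\<forall>x\<in>P. frattini #> conj_by G b x = frattini #> (x [^] k)"
proof -
  interpret PP: group PP by (rule PP_group)
  have T: "conj_by G b \<in> hom PP PP"
    using b by (auto intro!: homI simp: conj_by_mult_right)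
  have TM: "conj_by G b ` M \<subseteq> M" if "subgroup M PP" "card M * p = Coset.order PP" for M
    using bM[of M] that by (auto simp: index_p_iff)
  obtain k :: nat where k: "\<forall>M x. subgroup M PP \<longrightarrow> card M * p = Coset.order PP \<longrightarrow> x \<in> P \<longrightarrow>
      M #>\<^bsub>PP\<^esub> conj_by G b x = M #>\<^bsub>PP\<^esub> (x [^]\<^bsub>PP\<^esub> k)"
  proof (rule PP.p_group_power_map[OF prime_p PP_order T TM])
    fix k :: nat
    assume *: "\<And>M x. subgroup M PP \<Longrightarrow> card M * p = Coset.order PP \<Longrightarrow> x \<in> carrier PP \<Longrightarrow>
      M #>\<^bsub>PP\<^esub> conj_by G b x = M #>\<^bsub>PP\<^esub> (x [^]\<^bsub>PP\<^esub> k)"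
    show thesis
      by (rule that[of k], intro allI impI, rule *) simp_all
  qed
  have pw: "x [^] i \<in> P" if "x \<in> P" for x and i :: nat
    using that PP.nat_pow_closed[of x i] by (simp flip: nat_pow_consistent)
  have "frattini #> conj_by G b x = frattini #> (x [^] k)" if x: "x \<in> P" for x
  proof -
    have "conj_by G b x \<otimes> inv (x [^] k) \<in> M" if M: "index_p M" for M
    proof -
      interpret M: normal M PP by (rule index_p_normal[OF M])
      have "M #>\<^bsub>PP\<^esub> conj_by G b x = M #>\<^bsub>PP\<^esub> (x [^]\<^bsub>PP\<^esub> k)"
        using k M x unfolding index_p_iff by blast
      then have "conj_by G b x \<otimes>\<^bsub>PP\<^esub> inv\<^bsub>PP\<^esub> (x [^]\<^bsub>PP\<^esub> k) \<in> M"
        using M.rcos_eq_iff[of "conj_by G b x" "x [^]\<^bsub>PP\<^esub> k"] x b PP.nat_pow_closed[of x k] by simp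
      moreover have "inv\<^bsub>PP\<^esub> (x [^] k) = inv (x [^] k)"
        using pw[OF x] by (rule m_inv_consistent[OF P_subgroup])
      ultimately show ?thesis by (simp flip: nat_pow_consistent)
    qed
    moreover have "conj_by G b x \<otimes> inv (x [^] k) \<in> P"
      using x b pw[OF x] subgroup.m_closed[OF P_subgroup] subgroup.m_inv_closed[OF P_subgroup] by simp
    ultimately have "conj_by G b x \<otimes> inv (x [^] k) \<in> frattini"
      by (simp add: frattini_def)
    then show ?thesis using x b by (simp add: Phi.rcos_eq_iff)
  qed
  then show thesis using that[of k] by blast
qed

text \<open>Power maps commute with all automorphisms.\<close>

lemma commutator_in_frattini_kernel:
  assumes b: "b \<in> carrier G" and g: "g \<in> carrier G"
    and k: "\<forall>x\<in>P. frattini #> conj_by G b x = frattini #> (x [^] (k::nat))"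
  shows "inv (g \<otimes> b) \<otimes> (b \<otimes> g) \<in> frattini_kernel"
  unfolding frattini_kernel_iff
proof (intro conjI ballI)
  fix x assume x: "x \<in> P"
  have gx: "conj_by G g x \<in> P" using g x by simp
  have "frattini #> conj_by G g (conj_by G b x) = frattini #> conj_by G g (x [^] k)"
    using k x b g by (intro Phi.rcos_conj) auto
  also have "\<dots> = frattini #> conj_by G b (conj_by G g x)"
    using bspec[OF k gx] g x by (simp add: conj_by_nat_pow)
  finally have "frattini #> conj_by G (inv (g \<otimes> b)) (conj_by G (b \<otimes> g) x)
      = frattini #> conj_by G (inv (g \<otimes> b)) (conj_by G (g \<otimes> b) x)"
    using b g x by (intro Phi.rcos_conj) (auto simp: conj_by_mult_left)
  then show "frattini #> conj_by G (inv (g \<otimes> b) \<otimes> (b \<otimes> g)) x = frattini #> x"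
    using b g x conj_by_mult_left[of "inv (g \<otimes> b)" "b \<otimes> g" x] by simp
qed (use b g in simp)

text \<open>By Fermat the \<open>(p - 1)\<close>-st power of \<open>k\<close> is \<open>1\<close> modulo \<open>p\<close> unless \<open>p\<close> divides \<open>k\<close>; in the
  latter case conjugation by \<open>b\<close> maps \<open>P\<close> into \<open>frattini\<close>, so that \<open>P = frattini\<close>.\<close>

lemma power_in_frattini_kernel:
  assumes b: "b \<in> carrier G"
    and k: "\<forall>x\<in>P. frattini #> conj_by G b x = frattini #> (x [^] (k::nat))"
  shows "b [^] (p - 1) \<in> frattini_kernel"
  unfolding frattini_kernel_iff
proof (intro conjI ballI)
  fix x assume x: "x \<in> P"
  have pow: "frattini #> conj_by G (b [^] i) y = frattini #> (y [^] (k ^ i))" if y: "y \<in> P" for y i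
  proof (induction i)
    case 0
    then show ?case using y by simp
  next
    case (Suc i)
    have "frattini #> conj_by G (b [^] Suc i) y = frattini #> conj_by G (b [^] i) (conj_by G b y)"
      using b y by (simp add: conj_by_mult_left)
    also have "\<dots> = frattini #> conj_by G b (conj_by G (b [^] i) y)"
      using b y nat_pow_Suc2[OF b, of i] conj_by_mult_left[of b "b [^] i" y]
        conj_by_mult_left[of "b [^] i" b y] by simp
    also have "\<dots> = frattini #> conj_by G b (y [^] (k ^ i))"
      using Suc b y by (intro Phi.rcos_conj) auto
    also have "\<dots> = frattini #> ((conj_by G b y) [^] (k ^ i))"
      using b y by (simp add: conj_by_nat_pow)
    also have "\<dots> = frattini #> ((y [^] k) [^] (k ^ i))"
      using b y k by (intro Phi.rcos_nat_pow_cong) auto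
    also have "\<dots> = frattini #> (y [^] (k ^ Suc i))"
      using y by (simp add: nat_pow_pow)
    finally show ?case .
  qed
  have xp: "x [^] p \<in> frattini"
  proof -
    interpret PP: group PP by (rule PP_group)
    have "x [^] p \<in> P" using x PP.nat_pow_closed[of x p] by (simp flip: nat_pow_consistent)
    then show ?thesis using index_p_pow[OF _ x] by (simp add: frattini_def)
  qed
  have pw: "(x [^] p) [^] i \<in> frattini" for i :: nat
    using xp by (induction i) auto
  show "frattini #> conj_by G (b [^] (p - 1)) x = frattini #> x"
  proof (cases "p dvd k")
    case True
    then obtain t where "k = p * t" by blast
    then have "x [^] k \<in> frattini" using pw[of t] x by (simp add: nat_pow_pow)
    then have "frattini #> conj_by G b x = frattini"
      using k x coset_join2[of "x [^] k" frattini] Phi.subgroup_axioms by simp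
    then have "conj_by G b x \<in> frattini"
      using rcos_self[of "conj_by G b x" frattini] Phi.subgroup_axioms b x by simp
    then have "x \<in> frattini" using frattini_conj[of "inv b" "conj_by G b x"] b x by simp
    moreover have "conj_by G (b [^] (p - 1)) x \<in> frattini"
      using \<open>x \<in> frattini\<close> b by (intro frattini_conj) auto
    ultimately show ?thesis using b x by (simp add: Phi.rcos_eq_iff)
  next
    case False
    then have c: "[k ^ (p - 1) = 1] (mod p)" using fermat_theorem[OF prime_p] by simp
    have "k > 0" using False by (cases k) auto
    then have "k ^ (p - 1) \<ge> 1" by simp
    then obtain t where t: "k ^ (p - 1) = 1 + p * t"
      using c by (metis cong_sym cong_le_nat add.commute mult.commute)
    have "x [^] (k ^ (p - 1)) = (x [^] p) [^] t \<otimes> x"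
      using x unfolding t by (simp add: nat_pow_pow)
    then have "x [^] (k ^ (p - 1)) \<otimes> inv x \<in> frattini"
      using pw[of t] x by (simp add: m_assoc)
    then show ?thesis using pow[OF x, of "p - 1"] x by (simp add: Phi.rcos_eq_iff)
  qed
qed (use b in simp)

text \<open>Each \<open>b\<close> in \<open>B\<close> acts as a power map on a minimal normal subgroup \<open>W\<close> of \<open>G\<close> inside
  \<open>fixed_torsion\<close>, because its eigenspaces in \<open>W\<close> are normal in \<open>G\<close>. So invariance under \<open>G\<close> of a
  subgroup of \<open>W\<close> reduces to invariance under \<open>A\<close>, where the last hypothesis applies.\<close>

theorem ex_normal_prime_order_subgroup:
  assumes n: "n > 0"
    and AB: "A \<subseteq> carrier G" "B \<subseteq> carrier G" "carrier G = A <#> B"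
    and BM: "\<And>M b x. index_p M \<Longrightarrow> b \<in> B \<Longrightarrow> x \<in> M \<Longrightarrow> conj_by G b x \<in> M"
    and A_chief: "\<And>W. subgroup W G \<Longrightarrow> W \<subseteq> P \<Longrightarrow> W \<noteq> {\<one>} \<Longrightarrow> normalizes G A W \<Longrightarrow>
      \<exists>N. subgroup N G \<and> N \<subseteq> W \<and> normalizes G A N \<and> Factorial_Ring.prime (card N)"
  shows "\<exists>N. N \<lhd> G \<and> N \<subseteq> P \<and> Factorial_Ring.prime (card N)"
proof -
  define F where "F = {W. W \<lhd> G \<and> W \<subseteq> fixed_torsion \<and> W \<noteq> {\<one>}}"
  have fixed_torsion_P: "fixed_torsion \<subseteq> P" by (auto simp: fixed_torsion_def)
  have "finite F"
    by (rule finite_subset[of _ "Pow (carrier G)"])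
      (use fin in \<open>auto simp: F_def dest: normal_imp_subgroup subgroup.subset\<close>)
  moreover have "fixed_torsion \<in> F"
    using fixed_torsion_normal fixed_torsion_nontrivial[OF n] by (simp add: F_def)
  then have "F \<noteq> {}" by blast
  ultimately have "\<exists>W\<in>F. \<forall>U\<in>F. U \<subseteq> W \<longrightarrow> W = U"
    by (rule finite_has_minimal)
  then obtain W where W: "W \<in> F" and W_min: "\<forall>U\<in>F. U \<subseteq> W \<longrightarrow> W = U" by (rule bexE)
  have W': "W \<lhd> G" "W \<subseteq> fixed_torsion" "W \<noteq> {\<one>}" using W by (auto simp: F_def)
  interpret W: normal W G by (rule W'(1))
  have WP: "W \<subseteq> P" using W'(2) fixed_torsion_P by blast
  have Wconj: "conj_by G g x \<in> W" if "g \<in> carrier G" "x \<in> W" for g x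
    using W'(1) that by (simp add: normal_iff_normalizes normalizes_def)
  have power: "\<exists>k::nat. \<forall>x\<in>W. conj_by G b x = x [^] k" if bB: "b \<in> B" for b
  proof -
    have b: "b \<in> carrier G" using AB bB by blast
    obtain k :: nat where k: "\<forall>x\<in>P. frattini #> conj_by G b x = frattini #> (x [^] k)"
      by (rule power_map_mod_frattini[OF b BM[OF _ bB]])
    have comm: "conj_by G b (conj_by G g x) = conj_by G g (conj_by G b x)" if g: "g \<in> carrier G" and x: "x \<in> W" for g x
    proof -
      have xc: "x \<in> carrier G" using x by simp
      have "conj_by G (inv (g \<otimes> b) \<otimes> (b \<otimes> g)) x = x"
        using commutator_in_frattini_kernel[OF b g k] x W'(2) by (auto simp: fixed_torsion_def)
      then have "conj_by G (g \<otimes> b) (conj_by G (inv (g \<otimes> b)) (conj_by G (b \<otimes> g) x)) = conj_by G (g \<otimes> b) x"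
        using b g xc conj_by_mult_left[of "inv (g \<otimes> b)" "b \<otimes> g" x] by simp
      then show ?thesis using b g xc by (simp add: conj_by_mult_left)
    qed
    let ?W = "G\<lparr>carrier := W\<rparr>"
    interpret WW: group ?W by (rule W.subgroup_is_group[OF is_group])
    interpret WW: comm_group ?W
    proof (rule WW.group_comm_groupI)
      fix x y assume "x \<in> carrier ?W" "y \<in> carrier ?W"
      then show "x \<otimes>\<^bsub>?W\<^esub> y = y \<otimes>\<^bsub>?W\<^esub> x" using W'(2) fixed_torsion_commute by auto
    qed
    interpret E: comm_group_endo ?W "conj_by G b"
    proof
      show "conj_by G b \<in> hom ?W ?W"
        using b Wconj by (auto intro!: homI simp: conj_by_mult_right)
    qed
    have "\<not> W \<subseteq> {\<one>}" using W'(3) W.one_closed by blast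
    then obtain u where u: "u \<in> W" "u \<noteq> \<one>" by blast
    have iter: "(conj_by G b ^^ i) x = conj_by G (b [^] i) x" if "x \<in> carrier G" for i x
    proof (induction i)
      case (Suc i)
      then show ?case using b that nat_pow_Suc2[OF b, of i] by (simp add: conj_by_mult_left)
    qed (use that in simp)
    obtain j :: nat and w where w: "w \<in> carrier ?W" "w \<noteq> \<one>\<^bsub>?W\<^esub>" "conj_by G b w = w [^]\<^bsub>?W\<^esub> j"
    proof (rule E.ex_eigenvector[OF prime_p])
      show "x [^]\<^bsub>?W\<^esub> p = \<one>\<^bsub>?W\<^esub>" if "x \<in> carrier ?W" for x
        using that W'(2) by (auto simp: fixed_torsion_def simp flip: nat_pow_consistent)
      show "(conj_by G b ^^ (p - 1)) x = x" if "x \<in> carrier ?W" for x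
        using that W'(2) power_in_frattini_kernel[OF b k] iter[of x "p - 1"] by (auto simp: fixed_torsion_def)
      show "u \<in> carrier ?W" "u \<noteq> \<one>\<^bsub>?W\<^esub>" using u by simp_all
    qed
    define U where "U = {x \<in> W. conj_by G b x = x [^] j}"
    have "w \<in> U" "w \<noteq> \<one>" using w by (simp_all add: U_def flip: nat_pow_consistent)
    then have "U \<noteq> {\<one>}" by blast
    moreover have "U \<lhd> G"
      unfolding normal_iff_normalizes
    proof
      show "subgroup U G"
      proof (rule subgroupI)
        have "\<one> \<in> U" using b by (simp add: U_def)
        then show "U \<noteq> {}" by blast
      next
        fix x assume "x \<in> U"
        then show "inv x \<in> U" using b by (simp add: U_def conj_by_inv_right nat_pow_inv)
      next
        fix x y assume "x \<in> U" "y \<in> U"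
        then have x: "x \<in> W" "conj_by G b x = x [^] j" and y: "y \<in> W" "conj_by G b y = y [^] j"
          by (simp_all add: U_def)
        have "conj_by G b (x \<otimes> y) = x [^] j \<otimes> y [^] j"
          using b x y by (simp add: conj_by_mult_right)
        also have "\<dots> = (x \<otimes> y) [^] j"
          using fixed_torsion_pow_mult[of x y j] x(1) y(1) W'(2) by (simp add: subset_iff)
        finally show "x \<otimes> y \<in> U" using x(1) y(1) by (simp add: U_def)
      qed (auto simp: U_def)
      show "normalizes G (carrier G) U"
        using comm Wconj by (auto simp: U_def normalizes_def conj_by_nat_pow)
    qed
    moreover have UW: "U \<subseteq> W" by (auto simp: U_def)
    ultimately have "U \<in> F" using W'(2) by (simp add: F_def)
    then have "W = U" using W_min UW by blast
    then show ?thesis unfolding U_def by blast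
  qed
  have "normalizes G A W" using AB(1) Wconj by (auto simp: normalizes_def)
  then obtain N where N: "subgroup N G" "N \<subseteq> W" "normalizes G A N" "Factorial_Ring.prime (card N)"
    using A_chief[OF W.subgroup_axioms WP W'(3)] by blast
  have pw: "x [^] k \<in> N" if "x \<in> N" for x and k :: nat
    using that subgroup.m_closed[OF N(1)] subgroup.one_closed[OF N(1)] by (induction k) auto
  have "conj_by G g x \<in> N" if g: "g \<in> carrier G" and x: "x \<in> N" for g x
  proof -
    obtain a b where ab: "a \<in> A" "b \<in> B" "g = a \<otimes> b" using g AB(3) by (auto simp: set_mult_def)
    obtain k :: nat where "conj_by G b x = x [^] k" using power[OF ab(2)] x N(2) by blast
    then have "conj_by G b x \<in> N" using pw[OF x] by simp
    then have "conj_by G a (conj_by G b x) \<in> N" using N(3) ab(1) by (simp add: normalizes_def)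
    then show ?thesis
      using ab(3) conj_by_mult_left[of a b x] subsetD[OF AB(1) ab(1)] subsetD[OF AB(2) ab(2)]
        W.mem_carrier[OF subsetD[OF N(2) x]] by simp
  qed
  then have "N \<lhd> G" using N(1) by (simp add: normal_iff_normalizes normalizes_def)
  then show ?thesis using N WP by blast
qed

end

section \<open>Refinement by invariant subgroups of prime index\<close>

text \<open>Between any two nested \<open>A\<close>-invariant subgroups of \<open>A\<close> there is an \<open>A\<close>-invariant one that has prime index over
  the smaller. Everything is phrased inside the ambient group \<open>G\<close>, so that \<open>A\<close>-invariant subgroups
  can be compared with subgroups that are invariant under all of \<open>G\<close>.\<close>

definition prime_chief :: "('a, 'b) monoid_scheme \<Rightarrow> 'a set \<Rightarrow> bool" where
  "prime_chief G A \<longleftrightarrow> (\<forall>N W. subgroup N G \<longrightarrow> subgroup W G \<longrightarrow> N \<subset> W \<longrightarrow> W \<subseteq> A \<longrightarrow>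
     normalizes G A N \<longrightarrow> normalizes G A W \<longrightarrow>
     (\<exists>N' r. Factorial_Ring.prime r \<and> subgroup N' G \<and> N \<subseteq> N' \<and> N' \<subseteq> W \<and>
        normalizes G A N' \<and> card N' = r * card N))"

lemma prime_chiefD:
  assumes "prime_chief G A" "subgroup N G" "subgroup W G" "N \<subset> W" "W \<subseteq> A"
    "normalizes G A N" "normalizes G A W"
  obtains N' r where "Factorial_Ring.prime r" "subgroup N' G" "N \<subseteq> N'" "N' \<subseteq> W"
    "normalizes G A N'" "card N' = r * card N"
  using assms unfolding prime_chief_def by meson

text \<open>Let \<open>k\<close> be the least positive exponent with \<open>x\<^sup>k\<close> in \<open>N\<close>, and take \<open>m = k/r\<close> for a prime divisor
  \<open>r\<close> of \<open>k\<close>.\<close>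

lemma (in group) ex_power_prime_mod_subgroup:
  assumes fin: "finite (carrier G)" and N: "subgroup N G" and x: "x \<in> carrier G" "x \<notin> N"
  obtains m r :: nat where "Factorial_Ring.prime r" "x [^] m \<notin> N" "(x [^] m) [^] r \<in> N"
proof -
  define k where "k = (LEAST k::nat. k > 0 \<and> x [^] k \<in> N)"
  have "\<exists>k::nat. k > 0 \<and> x [^] k \<in> N"
    using pow_ord_eq_1[OF x(1)] ord_ge_1[OF fin x(1)] subgroup.one_closed[OF N]
    by (intro exI[of _ "ord x"]) simp
  then have k: "k > 0" "x [^] k \<in> N"
    unfolding k_def by (metis (mono_tags, lifting) LeastI_ex)+
  have least: "x [^] j \<notin> N" if "0 < j" "j < k" for j
    using not_less_Least[of j "\<lambda>k. k > 0 \<and> x [^] k \<in> N"] that by (simp add: k_def)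
  have "k \<noteq> 1" using k(2) x by auto
  then obtain r where r: "Factorial_Ring.prime r" "r dvd k" using prime_factor_nat by blast
  then obtain m where m: "k = m * r" by (metis dvd_def mult.commute)
  have "0 < m" "m < k" using m k(1) prime_gt_1_nat[OF r(1)] by auto
  then show thesis
    using that[OF r(1) least] k(2) x(1) by (simp add: nat_pow_pow m)
qed

lemma (in normal) rcos_int_pow_cong:
  assumes "x \<in> carrier G" "y \<in> carrier G" "H #> x = H #> y"
  shows "H #> (x [^] (k::int)) = H #> (y [^] k)"
  using FactGroup_int_pow[OF assms(1), of k] FactGroup_int_pow[OF assms(2), of k] assms(3) by simp

lemma (in group) conj_by_int_pow:
  "a \<in> carrier G \<Longrightarrow> x \<in> carrier G \<Longrightarrow> conj_by G a (x [^] (n::int)) = conj_by G a x [^] n"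
  using group_hom.hom_int_pow[OF conj_by_group_hom] .

text \<open>Every subgroup of a cyclic normal factor \<open>F/E\<close> is normal: if \<open>z\<close> generates \<open>F\<close> modulo \<open>E\<close> and
  conjugation by \<open>g\<close> maps \<open>z\<close> to \<open>z\<^sup>t\<close>, then it acts as the \<open>t\<close>-th power on all of \<open>F/E\<close>.\<close>

lemma (in group) cyclic_factor_conj_power:
  assumes E: "E \<lhd> G" and F: "F \<lhd> G" "E \<subseteq> F"
    and cyc: "cyclic_group ((G\<lparr>carrier := F\<rparr>) Mod E)"
    and g: "g \<in> carrier G" and y: "y \<in> F"
  obtains t :: int where "E #> conj_by G g y = E #> (y [^] t)"
proof -
  interpret E: normal E G by (rule E)
  have sF: "subgroup F G" using F(1) by (rule normal_imp_subgroup)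
  let ?F = "G\<lparr>carrier := F\<rparr>"
  interpret EF: normal E ?F
    using normal_restrict_supergroup[OF sF E F(2)] .
  interpret Q: group "?F Mod E" by (rule EF.factorgroup_is_group)
  obtain Z where Z: "Z \<in> carrier (?F Mod E)"
    and gen: "carrier (?F Mod E) = range (\<lambda>n::int. Z [^]\<^bsub>?F Mod E\<^esub> n)"
    using cyc unfolding Q.cyclic_group by blast
  obtain z where z: "z \<in> F" "Z = E #> z" using Z by (auto simp: carrier_FactGroup)
  have zc: "z \<in> carrier G" using z subgroup.mem_carrier[OF sF] by blast
  have pow: "\<exists>m::int. E #> u = E #> (z [^] m)" if u: "u \<in> F" for u
  proof -
    have "E #> u \<in> carrier (?F Mod E)" using u by (auto simp: carrier_FactGroup)
    then obtain m :: int where "E #> u = Z [^]\<^bsub>?F Mod E\<^esub> m" using gen by auto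
    also have "\<dots> = E #> (z [^] m)"
      using EF.FactGroup_int_pow[of z m] z int_pow_consistent[OF sF z(1), of m] by simp
    finally show ?thesis by blast
  qed
  obtain m :: int where m: "E #> y = E #> (z [^] m)" using pow[OF y] by blast
  have "conj_by G g z \<in> F" using F(1) g z by (simp add: normal_iff_normalizes normalizes_def)
  then obtain t :: int where t: "E #> conj_by G g z = E #> (z [^] t)" using pow by blast
  have yc: "y \<in> carrier G" using y subgroup.mem_carrier[OF sF] by blast
  have "E #> conj_by G g y = E #> conj_by G g (z [^] m)"
    using g yc zc m by (intro E.rcos_conj) auto
  also have "\<dots> = E #> (conj_by G g z [^] m)"
    using g zc by (simp add: conj_by_int_pow)
  also have "\<dots> = E #> ((z [^] t) [^] m)"
    using g zc t by (intro E.rcos_int_pow_cong) auto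
  also have "\<dots> = E #> ((z [^] m) [^] t)"
    using zc by (simp add: int_pow_pow mult.commute)
  also have "\<dots> = E #> (y [^] t)"
    using zc yc m by (intro E.rcos_int_pow_cong) auto
  finally show thesis by (rule that)
qed

text \<open>Let \<open>f i\<close> be the first member of a cyclic chain whose intersection with \<open>W\<close> is not contained in
  \<open>N\<close>. Extend \<open>N\<close> by an element \<open>y\<close> of \<open>f i \<inter> W\<close> that has prime order modulo \<open>N\<close>. The
  conjugates of \<open>y\<close> are powers of \<open>y\<close> modulo \<open>f j \<inter> W\<close> with \<open>j = i - 1\<close>, and this lies in \<open>N\<close>, so
  the extension is again normal.\<close>

lemma (in group) supersoluble_imp_prime_chief:
  assumes fin: "finite (carrier G)" and ss: "supersoluble G"
  shows "prime_chief G (carrier G)"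
  unfolding prime_chief_def
proof (intro allI impI)
  fix N W assume N: "subgroup N G" and W: "subgroup W G" "N \<subset> W" "W \<subseteq> carrier G"
    and nN: "normalizes G (carrier G) N" and nW: "normalizes G (carrier G) W"
  obtain n :: nat and f where f: "f 0 = {\<one>}" "f n = carrier G" "\<forall>i\<le>n. f i \<lhd> G"
    "\<forall>i<n. f i \<subseteq> f (Suc i) \<and> cyclic_group ((G\<lparr>carrier := f (Suc i)\<rparr>) Mod f i)"
    using ss unfolding supersoluble_def by blast
  define i where "i = (LEAST i. \<not> f i \<inter> W \<subseteq> N)"
  have top: "\<not> f n \<inter> W \<subseteq> N" using W f(2) by blast
  have i: "\<not> f i \<inter> W \<subseteq> N" unfolding i_def by (rule LeastI[where P = "\<lambda>i. \<not> f i \<inter> W \<subseteq> N", OF top])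
  have "i \<le> n" unfolding i_def by (rule Least_le[where P = "\<lambda>i. \<not> f i \<inter> W \<subseteq> N", OF top])
  have "i \<noteq> 0" using i f(1) subgroup.one_closed[OF N] by (metis Int_lower1 empty_subsetI insert_subset subset_trans)
  then obtain j where j: "i = Suc j" by (cases i) auto
  have jn: "j < n" using \<open>i \<le> n\<close> j by simp
  have low: "f j \<inter> W \<subseteq> N"
    using not_less_Least[of j "\<lambda>i. \<not> f i \<inter> W \<subseteq> N"] j unfolding i_def by auto
  have E: "f j \<lhd> G" and F: "f i \<lhd> G" using f(3) jn j by auto
  have EF: "f j \<subseteq> f i" "cyclic_group ((G\<lparr>carrier := f i\<rparr>) Mod f j)" using f(4) jn j by auto
  have sF: "subgroup (f i) G" using F by (rule normal_imp_subgroup)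
  obtain x where x: "x \<in> f i" "x \<in> W" "x \<notin> N" using i by blast
  have xc: "x \<in> carrier G" using x W(3) by blast
  obtain m r :: nat where r: "Factorial_Ring.prime r" "x [^] m \<notin> N" "(x [^] m) [^] r \<in> N"
    using ex_power_prime_mod_subgroup[OF fin N xc x(3)] .
  let ?y = "x [^] m"
  have y: "?y \<in> f i" "?y \<in> W" "?y \<in> carrier G"
    using subgroup_int_pow_closed[OF sF x(1), of "int m"] subgroup_int_pow_closed[OF W(1) x(2), of "int m"] xc
    by (simp_all add: int_pow_int)
  interpret N: normal N G using N nN by (simp add: normal_iff_normalizes)
  interpret E: normal "f j" G by (rule E)
  obtain L where L: "subgroup L G" "N \<subseteq> L" "card L = card N * r"
    "\<forall>u\<in>carrier G. u \<in> L \<longleftrightarrow> (\<exists>j::nat. N #> u = N #> (?y [^] j))"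
    using N.cyclic_extension[OF fin y(3) r(2) r(1) r(3)] .
  have yL: "?y \<in> L" using bspec[OF L(4) y(3)] y(3) by (metis nat_pow_eone)
  have split: "\<exists>n\<in>N. \<exists>j::nat. u = n \<otimes> ?y [^] j" if u: "u \<in> L" for u
  proof -
    have uc: "u \<in> carrier G" using u subgroup.mem_carrier[OF L(1)] by blast
    then obtain j :: nat where "N #> u = N #> (?y [^] j)" using bspec[OF L(4) uc] u by blast
    then have "u \<otimes> inv (?y [^] j) \<in> N" using N.rcos_eq_iff uc y(3) by simp
    moreover have "u = (u \<otimes> inv (?y [^] j)) \<otimes> ?y [^] j" using uc y(3) by (simp add: m_assoc)
    ultimately show ?thesis by blast
  qed
  have "L \<subseteq> W"
  proof
    fix u assume "u \<in> L"
    then obtain n j where "n \<in> N" "u = n \<otimes> ?y [^] (j::nat)" using split by blast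
    moreover have "?y [^] j \<in> W"
      using subgroup_int_pow_closed[OF W(1) y(2), of "int j"] by (simp add: int_pow_int)
    ultimately show "u \<in> W" using W(2) subgroup.m_closed[OF W(1)] by blast
  qed
  moreover have "normalizes G (carrier G) L"
    unfolding normalizes_def
  proof (intro ballI)
    fix g u assume g: "g \<in> carrier G" and u: "u \<in> L"
    obtain n k where n: "n \<in> N" "u = n \<otimes> ?y [^] (k::nat)" using split[OF u] by blast
    obtain t :: int where t: "f j #> conj_by G g ?y = f j #> (?y [^] t)"
      using cyclic_factor_conj_power[OF E F EF g y(1)] .
    have "conj_by G g ?y \<otimes> inv (?y [^] t) \<in> f j"
      using t E.rcos_eq_iff g y(3) by simp
    moreover have "conj_by G g ?y \<otimes> inv (?y [^] t) \<in> W"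
      using nW g y(2) subgroup_int_pow_closed[OF W(1) y(2), of t]
        subgroup.m_closed[OF W(1)] subgroup.m_inv_closed[OF W(1)] by (simp add: normalizes_def)
    ultimately have "conj_by G g ?y \<otimes> inv (?y [^] t) \<in> L" using low L(2) by blast
    then have "(conj_by G g ?y \<otimes> inv (?y [^] t)) \<otimes> ?y [^] t \<in> L"
      using subgroup_int_pow_closed[OF L(1) yL, of t] subgroup.m_closed[OF L(1)] by blast
    then have "conj_by G g ?y \<in> L" using g y(3) by (simp add: m_assoc)
    then have "conj_by G g (?y [^] k) \<in> L"
      using subgroup_int_pow_closed[OF L(1), of "conj_by G g ?y" "int k"] g y(3)
      by (simp add: int_pow_int conj_by_nat_pow)
    moreover have "conj_by G g n \<in> L" using nN g n(1) L(2) by (auto simp: normalizes_def)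
    ultimately show "conj_by G g u \<in> L"
      using g n y(3) subgroup.m_closed[OF L(1)] by (simp add: conj_by_mult_right)
  qed
  ultimately show "\<exists>N' r. Factorial_Ring.prime r \<and> subgroup N' G \<and> N \<subseteq> N' \<and> N' \<subseteq> W \<and>
      normalizes G (carrier G) N' \<and> card N' = r * card N"
    using L r(1) by (intro exI[of _ L] exI[of _ r]) simp
qed

lemma (in group) normalizes_restrict:
  assumes "subgroup A G" "N \<subseteq> A"
  shows "normalizes (G\<lparr>carrier := A\<rparr>) A N \<longleftrightarrow> normalizes G A N"
  using assms m_inv_consistent[OF assms(1)] by (simp add: normalizes_def conj_by_def)

lemma (in group) subgroup_restrict_iff:
  assumes "subgroup A G"
  shows "subgroup N (G\<lparr>carrier := A\<rparr>) \<longleftrightarrow> subgroup N G \<and> N \<subseteq> A"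
  using incl_subgroup[OF assms, of N] subgroup_incl[of N A] assms subgroup.subset[of N "G\<lparr>carrier := A\<rparr>"]
  by auto

lemma (in group) prime_chief_restrict:
  assumes A: "subgroup A G"
  shows "prime_chief (G\<lparr>carrier := A\<rparr>) A \<longleftrightarrow> prime_chief G A"
proof -
  let ?A = "G\<lparr>carrier := A\<rparr>"
  have inv_iff: "subgroup N ?A \<and> normalizes ?A A N \<longleftrightarrow> subgroup N G \<and> N \<subseteq> A \<and> normalizes G A N" for N
    using subgroup_restrict_iff[OF A] normalizes_restrict[OF A] by blast
  show ?thesis
  proof
    assume L: "prime_chief ?A A"
    show "prime_chief G A"
      unfolding prime_chief_def
    proof (intro allI impI)
      fix N W assume *: "subgroup N G" "subgroup W G" "N \<subset> W" "W \<subseteq> A" "normalizes G A N" "normalizes G A W"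
      then have N: "subgroup N ?A \<and> normalizes ?A A N" and W: "subgroup W ?A \<and> normalizes ?A A W"
        unfolding inv_iff by auto
      obtain N' r where "Factorial_Ring.prime r" "subgroup N' ?A" "N \<subseteq> N'" "N' \<subseteq> W"
        "normalizes ?A A N'" "card N' = r * card N"
        using prime_chiefD[OF L conjunct1[OF N] conjunct1[OF W] *(3,4) conjunct2[OF N] conjunct2[OF W]] .
      then show "\<exists>N' r. Factorial_Ring.prime r \<and> subgroup N' G \<and> N \<subseteq> N' \<and> N' \<subseteq> W \<and>
          normalizes G A N' \<and> card N' = r * card N"
        using inv_iff[of N'] by (intro exI[of _ N'] exI[of _ r]) simp
    qed
  next
    assume L: "prime_chief G A"
    show "prime_chief ?A A"
      unfolding prime_chief_def
    proof (intro allI impI)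
      fix N W assume *: "subgroup N ?A" "subgroup W ?A" "N \<subset> W" "W \<subseteq> A" "normalizes ?A A N" "normalizes ?A A W"
      then have N: "subgroup N G" "normalizes G A N" and W: "subgroup W G" "normalizes G A W"
        using inv_iff[of N] inv_iff[of W] by simp_all
      obtain N' r where N': "Factorial_Ring.prime r" "subgroup N' G" "N \<subseteq> N'" "N' \<subseteq> W"
        "normalizes G A N'" "card N' = r * card N"
        using prime_chiefD[OF L N(1) W(1) *(3,4) N(2) W(2)] .
      moreover have "N' \<subseteq> A" using N'(4) *(4) by (rule order_trans)
      ultimately show "\<exists>N' r. Factorial_Ring.prime r \<and> subgroup N' ?A \<and> N \<subseteq> N' \<and> N' \<subseteq> W \<and>
          normalizes ?A A N' \<and> card N' = r * card N"
        using inv_iff[of N'] by (intro exI[of _ N'] exI[of _ r]) simp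
    qed
  qed
qed

lemma (in normal) Union_image_rcos:
  assumes M: "subgroup M G" "H \<subseteq> M"
  shows "\<Union>((\<lambda>x. H #> x) ` M) = M"
proof
  show "M \<subseteq> \<Union>((\<lambda>x. H #> x) ` M)"
    using rcos_self[OF subgroup.mem_carrier[OF M(1)] subgroup_axioms] by blast
  show "\<Union>((\<lambda>x. H #> x) ` M) \<subseteq> M"
    using M subgroup.m_closed[OF M(1)] by (auto simp: r_coset_def)
qed

lemma (in normal) subgroup_image_rcos:
  assumes "subgroup M G"
  shows "subgroup ((\<lambda>x. H #> x) ` M) (G Mod H)"
  by (rule group_hom.subgroup_img_is_subgroup[OF _ assms])
    (intro group_hom.intro group_hom_axioms.intro is_group factorgroup_is_group r_coset_hom_Mod)

lemma (in normal) conj_by_rcos: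
  assumes "g \<in> carrier G" "x \<in> carrier G"
  shows "conj_by (G Mod H) (H #> g) (H #> x) = H #> conj_by G g x"
  using assms inv_FactGroup[of "H #> g"] rcos_inv[of g]
  by (simp add: conj_by_def rcos_sum carrier_FactGroup)

text \<open>Pull the two given subgroups back to \<open>G\<close>, refine there, and project.\<close>

lemma (in normal) prime_chief_Mod:
  assumes fin: "finite (carrier G)" and A: "subgroup A G" "H \<subseteq> A" and pc: "prime_chief G A"
  shows "prime_chief (G Mod H) ((\<lambda>x. H #> x) ` A)"
  unfolding prime_chief_def
proof (intro allI impI)
  let ?A = "(\<lambda>x. H #> x) ` A"
  fix X Y assume X: "subgroup X (G Mod H)" and Y: "subgroup Y (G Mod H)" "X \<subset> Y" "Y \<subseteq> ?A"
    and nX: "normalizes (G Mod H) ?A X" and nY: "normalizes (G Mod H) ?A Y"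
  have cH: "card H > 0" using fin finite_imp_card_positive by simp
  have sX: "subgroup (\<Union>X) G" and sY: "subgroup (\<Union>Y) G"
    using factgroup_subgroup_union_subgroup X Y(1) by auto
  have "\<Union>Y \<subseteq> \<Union>?A" using Y(3) by blast
  then have YA: "\<Union>Y \<subseteq> A" using Union_image_rcos[OF A] by simp
  have nU: "normalizes G A (\<Union>Z)" if Z: "subgroup Z (G Mod H)" and nZ: "normalizes (G Mod H) ?A Z" for Z
    unfolding normalizes_def
  proof (intro ballI)
    fix a u assume a: "a \<in> A" and u: "u \<in> \<Union>Z"
    have ac: "a \<in> carrier G" using a subgroup.mem_carrier[OF A(1)] by blast
    have uc: "u \<in> carrier G"
      using u subgroup.mem_carrier[OF factgroup_subgroup_union_subgroup[OF Z]] by blast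
    have "H #> u \<in> Z" using u mem_Union_subgroup_Mod[OF Z uc] by simp
    then have "H #> conj_by G a u \<in> Z"
      using nZ a conj_by_rcos[OF ac uc] unfolding normalizes_def by (metis image_eqI)
    then show "conj_by G a u \<in> \<Union>Z" using mem_Union_subgroup_Mod[OF Z] ac uc by simp
  qed
  have XY: "\<Union>X \<subset> \<Union>Y"
  proof
    show "\<Union>X \<subseteq> \<Union>Y" using Y(2) by blast
    have "finite Y"
      using finite_subset[OF subgroup.subset[OF Y(1)]] fin by (simp add: carrier_FactGroup)
    then have "card X < card Y" using Y(2) by (rule psubset_card_mono)
    then show "\<Union>X \<noteq> \<Union>Y"
      using card_Union_subgroup_Mod[OF fin X] card_Union_subgroup_Mod[OF fin Y(1)] cH by auto
  qed
  obtain M r where r: "Factorial_Ring.prime r" and M: "subgroup M G" "\<Union>X \<subseteq> M" "M \<subseteq> \<Union>Y"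
    "normalizes G A M" "card M = r * card (\<Union>X)"
    using prime_chiefD[OF pc sX sY XY YA nU[OF X nX] nU[OF Y(1) nY]] .
  let ?M = "(\<lambda>x. H #> x) ` M"
  have HM: "H \<subseteq> M" using M(2) subgroup.one_closed[OF X] by auto
  have sM: "subgroup ?M (G Mod H)" by (rule subgroup_image_rcos[OF M(1)])
  have UM: "\<Union>?M = M" by (rule Union_image_rcos[OF M(1) HM])
  have "X \<subseteq> ?M"
  proof
    fix C assume C: "C \<in> X"
    then obtain u where u: "u \<in> carrier G" "C = H #> u"
      using subgroup.subset[OF X] by (auto simp: carrier_FactGroup)
    then have "u \<in> \<Union>X" using mem_Union_subgroup_Mod[OF X u(1)] C by simp
    then show "C \<in> ?M" using M(2) u(2) by blast
  qed
  moreover have "?M \<subseteq> Y"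
    using M(3) mem_Union_subgroup_Mod[OF Y(1)] subgroup.mem_carrier[OF M(1)] by blast
  moreover have "normalizes (G Mod H) ?A ?M"
    using M(4) subgroup.mem_carrier[OF M(1)] subgroup.mem_carrier[OF A(1)]
    by (auto simp: normalizes_def conj_by_rcos)
  moreover have "card ?M = r * card X"
    using card_Union_subgroup_Mod[OF fin sM] card_Union_subgroup_Mod[OF fin X] M(5) cH
    unfolding UM by (simp add: mult.left_commute)
  ultimately show "\<exists>N' r. Factorial_Ring.prime r \<and> subgroup N' (G Mod H) \<and> X \<subseteq> N' \<and> N' \<subseteq> Y \<and>
      normalizes (G Mod H) ?A N' \<and> card N' = r * card X"
    using sM r by blast
qed

lemma (in group) subgroup_nat_pow_closed:
  "subgroup H G \<Longrightarrow> x \<in> H \<Longrightarrow> x [^] (n::nat) \<in> H"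
  using subgroup_int_pow_closed[of H x "int n"] by (simp only: int_pow_int)

lemma (in group) card_set_mult_disjoint:
  assumes A: "subgroup A G" and S: "subgroup S G" and disj: "A \<inter> S = {\<one>}"
  shows "card (A <#> S) = card A * card S"
proof -
  note Ac = subgroup.mem_carrier[OF A] and Sc = subgroup.mem_carrier[OF S]
  have "inj_on (\<lambda>(a, s). a \<otimes> s) (A \<times> S)"
  proof (rule inj_onI, clarify)
    fix a s a' s' assume h: "a \<in> A" "s \<in> S" "a' \<in> A" "s' \<in> S" "a \<otimes> s = a' \<otimes> s'"
    have cc: "a \<in> carrier G" "a' \<in> carrier G" "s \<in> carrier G" "s' \<in> carrier G" using h Ac Sc by auto
    have "a = (a \<otimes> s) \<otimes> inv s" using cc by (simp add: m_assoc)
    also have "\<dots> = a' \<otimes> (s' \<otimes> inv s)" using h(5) cc by (simp add: m_assoc)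
    finally have e: "inv a' \<otimes> a = s' \<otimes> inv s"
      using cc m_assoc[of "inv a'" a' "s' \<otimes> inv s"] by simp
    have "inv a' \<otimes> a \<in> A" using h subgroup.m_closed[OF A] subgroup.m_inv_closed[OF A] by simp
    moreover have "s' \<otimes> inv s \<in> S" using h subgroup.m_closed[OF S] subgroup.m_inv_closed[OF S] by simp
    ultimately have "inv a' \<otimes> a = \<one>" using e disj by auto
    then have "a = a'" using cc m_assoc[of a' "inv a'" a] by simp
    then show "a = a' \<and> s = s'" using h(5) cc by simp
  qed
  moreover have "A <#> S = (\<lambda>(a, s). a \<otimes> s) ` (A \<times> S)" by (auto simp: set_mult_def)
  ultimately show ?thesis by (simp add: card_image card_cartesian_product)
qed

section \<open>The normal Sylow subgroup for the largest prime\<close>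

text \<open>A Sylow \<open>p\<close>-subgroup \<open>P\<close> acts by conjugation on \<open>C\<close>, which has fewer than \<open>p\<close> elements, so it moves
  none of them. Hence \<open>G\<close> is the direct product of \<open>C\<close> and \<open>P\<close>, and \<open>P\<close> consists of the elements
  of \<open>p\<close>-power order.\<close>

lemma (in group) p_elements_of_prime_by_p_group:
  assumes fin: "finite (carrier G)" and p: "Factorial_Ring.prime p" and r: "Factorial_Ring.prime r" "r < p"
    and ord: "Coset.order G = p ^ a * r" and C: "C \<lhd> G" "card C = r"
  shows "subgroup {x \<in> carrier G. \<exists>j::nat. x [^] (p ^ j) = \<one>} G"
    and "card {x \<in> carrier G. \<exists>j::nat. x [^] (p ^ j) = \<one>} = p ^ a"
proof -
  obtain P where P: "subgroup P G" "card P = p ^ a"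
    using sylow_thm[OF p is_group ord fin] by blast
  interpret C: normal C G by (rule C(1))
  interpret P: subgroup P G by (rule P(1))
  interpret PP: group "G\<lparr>carrier := P\<rparr>" by (rule P.subgroup_is_group[OF is_group])
  interpret CC: group "G\<lparr>carrier := C\<rparr>" by (rule C.subgroup_is_group[OF is_group])
  have finC: "finite C" using C.subset fin finite_subset by blast
  have powC: "c [^] r = \<one>" if "c \<in> C" for c
    using CC.pow_order_eq_1[of c] that C(2) by (simp add: Coset.order_def flip: nat_pow_consistent)
  have powP: "y [^] (p ^ a) = \<one>" if "y \<in> P" for y
    using PP.pow_order_eq_1[of y] that P(2) by (simp add: Coset.order_def flip: nat_pow_consistent)
  have cop: "c = \<one>" if c: "c \<in> C" "c [^] (p ^ j) = \<one>" for c j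
  proof -
    have "ord c dvd r" "ord c dvd p ^ j"
      using pow_eq_id[of c] powC c C.mem_carrier by auto
    moreover have "coprime r (p ^ j)"
      using primes_coprime[OF r(1) p] r(2) by simp
    ultimately have "ord c = 1" using coprime_common_divisor_nat by blast
    then show ?thesis using ord_eq_1[of c] c by auto
  qed
  let ?M = "{x \<in> C. \<exists>g\<in>carrier (G\<lparr>carrier := P\<rparr>). conj_by G g x \<noteq> x}"
  have "p dvd card ?M"
  proof (rule PP.p_group_dvd_card_moved_points[OF p _ finC, of a])
    show "Coset.order (G\<lparr>carrier := P\<rparr>) = p ^ a" using P(2) by (simp add: Coset.order_def)
    show "conj_by G g x \<in> C" if "g \<in> carrier (G\<lparr>carrier := P\<rparr>)" "x \<in> C" for g x
      using C(1) that by (simp add: normal_iff_normalizes normalizes_def)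
  qed (auto simp: conj_by_mult_left)
  moreover have "card ?M < p"
    using card_mono[OF finC, of ?M] C(2) r(2) by auto
  ultimately have "card ?M = 0" by (meson dvd_imp_le linorder_not_less neq0_conv)
  then have "?M = {}" using finC by simp
  then have comm: "y \<otimes> c = c \<otimes> y" if "y \<in> P" "c \<in> C" for y c
    using that conj_by_eq_iff[of y c c] by auto
  have "C \<inter> P \<subseteq> {\<one>}" using cop powP by blast
  then have disj: "C \<inter> P = {\<one>}" using C.one_closed P.one_closed by blast
  have "card (C <#> P) = card (carrier G)"
    using card_set_mult_disjoint[OF C.subgroup_axioms P(1) disj] C(2) P(2) ord
    by (simp add: Coset.order_def mult.commute)
  then have prod: "C <#> P = carrier G"
    by (intro card_subset_eq[OF fin] set_mult_closed C.subset P.subset)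
  have fact: "\<exists>c\<in>C. \<exists>y\<in>P. x = c \<otimes> y" if "x \<in> carrier G" for x
  proof -
    have "x \<in> C <#> P" unfolding prod by (rule that)
    then show ?thesis by (auto simp: set_mult_def)
  qed
  have "{x \<in> carrier G. \<exists>j::nat. x [^] (p ^ j) = \<one>} = P"
  proof (intro equalityI subsetI)
    fix x assume "x \<in> P"
    then show "x \<in> {x \<in> carrier G. \<exists>j::nat. x [^] (p ^ j) = \<one>}" using powP[of x] P.mem_carrier[of x] by blast
  next
    fix x assume "x \<in> {x \<in> carrier G. \<exists>j::nat. x [^] (p ^ j) = \<one>}"
    then obtain j :: nat where x: "x \<in> carrier G" "x [^] (p ^ j) = \<one>" by blast
    obtain c y where cy: "c \<in> C" "y \<in> P" "x = c \<otimes> y" using fact[OF x(1)] by blast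
    have cc: "c \<in> carrier G" "y \<in> carrier G" using cy by auto
    let ?k = "p ^ j"
    have "c [^] ?k \<otimes> y [^] ?k = \<one>"
      using x(2) pow_mult_distrib[OF comm[OF cy(2,1), symmetric] cc, of ?k] unfolding cy(3) by simp
    then have "c [^] ?k = inv (y [^] ?k)" using cc by (simp add: inv_equality)
    then have "c [^] ?k \<in> P"
      using subgroup_nat_pow_closed[OF P(1) cy(2), of ?k] by simp
    then have "(c [^] ?k) [^] (p ^ a) = \<one>" by (rule powP)
    then have "c [^] (p ^ (j + a)) = \<one>" using cc by (simp add: nat_pow_pow power_add)
    then have "c = \<one>" by (rule cop[OF cy(1)])
    then show "x \<in> P" using cy cc by simp
  qed
  then show "subgroup {x \<in> carrier G. \<exists>j::nat. x [^] (p ^ j) = \<one>} G"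
    "card {x \<in> carrier G. \<exists>j::nat. x [^] (p ^ j) = \<one>} = p ^ a"
    using P by simp_all
qed

lemma (in group) subgroup_card_dvd_order: "subgroup H G \<Longrightarrow> card H dvd Coset.order G"
  unfolding lagrange[symmetric] by simp

lemma (in normal) prime_index_pow_in:
  assumes fin: "finite (carrier G)" and M: "subgroup M G" "H \<subseteq> M" "card M = p * card H"
    and p: "Factorial_Ring.prime p" and x: "x \<in> M"
  shows "x [^] p \<in> H"
proof -
  interpret HM: normal H "G\<lparr>carrier := M\<rparr>"
    using normal_restrict_supergroup[OF M(1) normal_axioms M(2)] .
  have "finite M" using fin finite_subset[OF subgroup.subset[OF M(1)]] by blast
  then have "x [^]\<^bsub>G\<lparr>carrier := M\<rparr>\<^esub> p \<in> H"
    using HM.index_prime_pow_in[OF p] M(3) x by (simp add: Coset.order_def mult.commute)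
  then show ?thesis by (simp flip: nat_pow_consistent)
qed

text \<open>The elements of \<open>p\<close>-power order modulo \<open>N\<close> form a normal Sylow \<open>p\<close>-subgroup of \<open>G/N\<close> if \<open>p\<close>
  bounds the prime divisors of \<open>|G/N|\<close>. Describing it by its elements makes it visibly characteristic.
  The proof descends from \<open>N = G\<close>: if \<open>N'\<close> is normal of prime index \<open>r\<close> over \<open>N\<close>, then \<open>S N = S N'\<close> for
  \<open>r = p\<close>; for \<open>r < p\<close> the set \<open>S N\<close> is found inside \<open>S N'\<close>, whose quotient by \<open>N\<close> is
  an extension of a group of order \<open>r\<close> by a \<open>p\<close>-group.\<close>

lemma (in group) p_elements_mod_subgroup:
  assumes fin: "finite (carrier G)" and pc: "prime_chief G (carrier G)" and p: "Factorial_Ring.prime p"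
    and N: "N \<lhd> G"
    and le: "\<And>r. Factorial_Ring.prime r \<Longrightarrow> r * card N dvd Coset.order G \<Longrightarrow> r \<le> p"
  defines "S \<equiv> \<lambda>N. {x \<in> carrier G. \<exists>j::nat. x [^] (p ^ j) \<in> N}"
  shows "subgroup (S N) G \<and> (\<exists>a. card (S N) = p ^ a * card N) \<and> \<not> p * card (S N) dvd Coset.order G"
  using N le
proof (induction "card (carrier G) - card N" arbitrary: N rule: less_induct)
  case less
  interpret N: normal N G by (rule less.prems(1))
  have p1: "p > 1" using p by (rule prime_gt_1_nat)
  have cN: "card N > 0" using fin N.finite_imp_card_positive by simp
  show ?case
  proof (cases "N = carrier G")
    case True
    have "S N = carrier G"
      unfolding S_def True by auto
    moreover have "\<not> p * card (carrier G) dvd Coset.order G"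
      using p1 cN True by (auto simp: Coset.order_def dest: dvd_imp_le)
    ultimately show ?thesis
      using True subgroup_self by (auto intro: exI[of _ 0])
  next
    case False
    have nN: "normalizes G (carrier G) N" "normalizes G (carrier G) (carrier G)"
      using less.prems(1) by (simp_all add: normal_iff_normalizes normalizes_def)
    have "N \<subset> carrier G" using False N.subset by blast
    then obtain N' r where r: "Factorial_Ring.prime r" and N': "subgroup N' G" "N \<subseteq> N'" "N' \<subseteq> carrier G"
      "normalizes G (carrier G) N'" "card N' = r * card N"
      by (rule prime_chiefD[OF pc N.subgroup_axioms subgroup_self _ order_refl nN])
    have N'n: "N' \<lhd> G" using N' by (simp add: normal_iff_normalizes)
    have r1: "r > 1" using r by (rule prime_gt_1_nat)
    have "card N' dvd Coset.order G" by (rule subgroup_card_dvd_order[OF N'(1)])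
    then have rp: "r \<le> p" using less.prems(2)[OF r] N'(5) by simp
    have lt: "card (carrier G) - card N' < card (carrier G) - card N"
    proof -
      have "card N' \<le> card (carrier G)" using card_mono[OF fin N'(3)] .
      moreover have "card N < card N'" using N'(5) r1 cN by simp
      ultimately show ?thesis by linarith
    qed
    have le': "s \<le> p" if "Factorial_Ring.prime s" "s * card N' dvd Coset.order G" for s
    proof (rule less.prems(2)[OF that(1)])
      have "s * card N dvd s * card N'" using N'(5) by simp
      then show "s * card N dvd Coset.order G" using that(2) dvd_trans by blast
    qed
    have "subgroup (S N') G \<and> (\<exists>a. card (S N') = p ^ a * card N') \<and> \<not> p * card (S N') dvd Coset.order G"
      by (rule less.hyps[OF lt N'n le'])
    then obtain a where IH: "subgroup (S N') G" "card (S N') = p ^ a * card N'" "\<not> p * card (S N') dvd Coset.order G"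
      by blast
    have sub: "S N \<subseteq> S N'" unfolding S_def using N'(2) by blast
    show ?thesis
    proof (cases "r = p")
      case True
      have "S N' \<subseteq> S N"
      proof
        fix x assume "x \<in> S N'"
        then obtain j :: nat where x: "x \<in> carrier G" "x [^] (p ^ j) \<in> N'" by (auto simp: S_def)
        have "(x [^] (p ^ j)) [^] p \<in> N"
          using N.prime_index_pow_in[OF fin N'(1,2) _ p x(2)] N'(5) True by simp
        then have "x [^] (p ^ Suc j) \<in> N" using x(1) by (simp add: nat_pow_pow mult.commute)
        then show "x \<in> S N" using x(1) unfolding S_def by blast
      qed
      then have "S N = S N'" using sub by blast
      moreover have "p ^ a * card N' = p ^ Suc a * card N" using N'(5) True by simp
      ultimately show ?thesis using IH by metis
    next
      case False
      then have rp: "r < p" using rp by simp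
      let ?K = "G\<lparr>carrier := S N'\<rparr>"
      have NS: "N' \<subseteq> S N'" unfolding S_def using N'(3) by (auto intro!: exI[of _ 0])
      interpret K: group ?K by (rule subgroup.subgroup_is_group[OF IH(1) is_group])
      interpret NK: normal N ?K
        using normal_restrict_supergroup[OF IH(1) less.prems(1)] NS N'(2) by blast
      have N'K: "subgroup N' ?K" by (rule subgroup_incl[OF N'(1) IH(1) NS])
      have finK: "finite (carrier ?K)" using fin finite_subset[OF subgroup.subset[OF IH(1)]] by simp
      interpret Q: group "?K Mod N" by (rule NK.factorgroup_is_group)
      let ?C = "(\<lambda>x. N #>\<^bsub>?K\<^esub> x) ` N'"
      have C: "subgroup ?C (?K Mod N)" by (rule NK.subgroup_image_rcos[OF N'K])
      have cC: "card ?C = r"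
        using NK.card_Union_subgroup_Mod[OF finK C] NK.Union_image_rcos[OF N'K N'(2)] N'(5) cN by simp
      have ordQ: "Coset.order (?K Mod N) = p ^ a * r"
        using K.lagrange[OF NK.subgroup_axioms] IH(2) N'(5) cN
        by (simp add: Coset.order_def FactGroup_def)
      have finQ: "finite (carrier (?K Mod N))" using finK by (simp add: carrier_FactGroup)
      have "normalizes (?K Mod N) (carrier (?K Mod N)) ?C"
      proof -
        have N'n': "N' \<lhd> ?K" by (rule normal_restrict_supergroup[OF IH(1) N'n NS])
        have "conj_by ?K g x \<in> N'" if "g \<in> S N'" "x \<in> N'" for g x
          using N'n' that by (simp add: K.normal_iff_normalizes normalizes_def)
        then show ?thesis
          using NK.conj_by_rcos NS unfolding normalizes_def carrier_FactGroup by auto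
      qed
      then have Cn: "?C \<lhd> ?K Mod N" using C by (simp add: Q.normal_iff_normalizes)
      let ?P = "{X \<in> carrier (?K Mod N). \<exists>j::nat. X [^]\<^bsub>?K Mod N\<^esub> (p ^ j) = \<one>\<^bsub>?K Mod N\<^esub>}"
      have P: "subgroup ?P (?K Mod N)" "card ?P = p ^ a"
        using Q.p_elements_of_prime_by_p_group[OF finQ p r rp ordQ Cn cC] by simp_all
      have mem: "x \<in> \<Union>?P \<longleftrightarrow> x \<in> S N" if x: "x \<in> S N'" for x
      proof -
        have xc: "x \<in> carrier G" using x by (simp add: S_def)
        have one: "N #> y = N \<longleftrightarrow> y \<in> N" if "y \<in> carrier G" for y
          using coset_join2[of y N] rcos_self[of y N] N.subgroup_axioms that by auto
        have "x \<in> \<Union>?P \<longleftrightarrow> N #>\<^bsub>?K\<^esub> x \<in> ?P"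
          using NK.mem_Union_subgroup_Mod[OF P(1)] x by simp
        also have "\<dots> \<longleftrightarrow> (\<exists>j::nat. N #> (x [^] (p ^ j)) = N)"
          using x NK.FactGroup_pow[of x] by (auto simp: carrier_FactGroup simp flip: nat_pow_consistent)
        also have "\<dots> \<longleftrightarrow> x \<in> S N"
          using one xc by (simp add: S_def)
        finally show ?thesis .
      qed
      have UK: "subgroup (\<Union>?P) ?K" by (rule NK.factgroup_subgroup_union_subgroup[OF P(1)])
      have "\<Union>?P \<subseteq> S N'" using subgroup.subset[OF UK] by simp
      then have U: "\<Union>?P = S N" using mem sub by blast
      have "subgroup (S N) G" using incl_subgroup[OF IH(1) UK] unfolding U .
      moreover have card: "card (S N) = p ^ a * card N"
        using NK.card_Union_subgroup_Mod[OF finK P(1)] P(2) unfolding U by simp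
      moreover have "\<not> p * card (S N) dvd Coset.order G"
      proof
        assume "p * card (S N) dvd Coset.order G"
        moreover have "r * card (S N) dvd Coset.order G"
        proof -
          have "card (S N') dvd Coset.order G" by (rule subgroup_card_dvd_order[OF IH(1)])
          then show ?thesis using IH(2) N'(5) card by (simp add: mult.left_commute)
        qed
        moreover obtain m where m: "Coset.order G = card (S N) * m"
          using \<open>r * card (S N) dvd _\<close> by (metis dvd_mult_right dvd_def)
        moreover have "card (S N) > 0" using card p1 cN by simp
        ultimately have "p dvd m" "r dvd m" by simp_all
        moreover have "coprime p r" using primes_coprime[OF p r] rp by simp
        ultimately have "p * r dvd m" by (rule divides_mult)
        then have "card (S N) * (p * r) dvd Coset.order G" using m by simp
        moreover have "card (S N) * (p * r) = p * card (S N')" using IH(2) N'(5) card by simp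
        ultimately show False using IH(3) by simp
      qed
      ultimately show ?thesis by blast
    qed
  qed
qed

section \<open>A normal subgroup of prime index over a given one\<close>

text \<open>All fibres of \<open>h\<close> over its image have the size of the kernel.\<close>

lemma (in group_hom) card_vimage_subset:
  assumes fin: "finite (carrier G)" and S: "S \<subseteq> h ` carrier G"
  shows "card {x \<in> carrier G. h x \<in> S} = card (kernel G H h) * card S"
proof -
  let ?F = "\<lambda>s. {x \<in> carrier G. h x = s}"
  have fib: "card (?F s) = card (kernel G H h)" if s: "s \<in> S" for s
  proof -
    obtain g where g: "g \<in> carrier G" "s = h g" using S s by blast
    have "?F s = (\<lambda>k. k \<otimes> g) ` kernel G H h"
    proof (intro equalityI subsetI)
      fix x assume "x \<in> ?F s"
      then have "x \<otimes> inv g \<in> kernel G H h" "x = (x \<otimes> inv g) \<otimes> g" 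
        using g by (auto simp: kernel_def G.m_assoc)
      then show "x \<in> (\<lambda>k. k \<otimes> g) ` kernel G H h" by blast
    qed (use g in \<open>auto simp: kernel_def\<close>)
    moreover have "inj_on (\<lambda>k. k \<otimes> g) (kernel G H h)"
      using g by (auto simp: inj_on_def kernel_def)
    ultimately show ?thesis by (simp add: card_image)
  qed
  have finS: "finite S" using S fin finite_surj by blast
  have "card (\<Union>s\<in>S. ?F s) = (\<Sum>s\<in>S. card (?F s))"
    using finS fin by (intro card_UN_disjoint) auto
  also have "\<dots> = card (kernel G H h) * card S" using fib by simp
  also have "(\<Union>s\<in>S. ?F s) = {x \<in> carrier G. h x \<in> S}" by blast
  finally show ?thesis .
qed

text \<open>The preimage \<open>U\<close> of the image of \<open>S\<close> contains \<open>S\<close>, so \<open>p\<^sup>v\<close> divides \<open>|U|\<close>. If the image of \<open>S\<close>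
  were smaller than the \<open>p\<close>-group \<open>D/H\<close>, another factor \<open>p\<close> would divide \<open>|D|\<close>.\<close>

lemma (in normal) sylow_subgroup_maps_onto:
  assumes fin: "finite (carrier G)" and p: "Factorial_Ring.prime p"
    and D: "subgroup D G" "H \<subseteq> D" "card D = p ^ a * card H"
    and S: "subgroup S G" "S \<subseteq> D" "card S = p ^ v" "\<not> p ^ Suc v dvd card D"
  shows "(\<lambda>x. H #> x) ` S = (\<lambda>x. H #> x) ` D"
proof (rule card_subset_eq)
  let ?S = "(\<lambda>x. H #> x) ` S" and ?D = "(\<lambda>x. H #> x) ` D"
  interpret Q: group "G Mod H" by (rule factorgroup_is_group)
  have cH: "card H > 0" using fin finite_imp_card_positive by simp
  show "finite ?D" using finite_subset[OF subgroup.subset[OF D(1)] fin] by simp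
  show sub: "?S \<subseteq> ?D" using S(2) by blast
  have sS: "subgroup ?S (G Mod H)" and sD: "subgroup ?D (G Mod H)"
    by (rule subgroup_image_rcos[OF S(1)], rule subgroup_image_rcos[OF D(1)])
  have cD: "card ?D = p ^ a"
    using card_Union_subgroup_Mod[OF fin sD] Union_image_rcos[OF D(1,2)] D(3) cH by simp
  let ?U = "\<Union>?S"
  have sU: "subgroup ?U G" by (rule factgroup_subgroup_union_subgroup[OF sS])
  have cU: "card ?U = card H * card ?S" by (rule card_Union_subgroup_Mod[OF fin sS])
  interpret QD: group "(G Mod H)\<lparr>carrier := ?D\<rparr>" by (rule subgroup.subgroup_is_group[OF sD Q.is_group])
  have "card ?S dvd p ^ a"
    using QD.subgroup_card_dvd_order[OF Q.subgroup_incl[OF sS sD sub]] cD by (simp add: Coset.order_def)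
  then obtain c where c: "c \<le> a" "card ?S = p ^ c"
    using divides_primepow_nat[OF p] by blast
  have SU: "S \<subseteq> ?U" using rcos_self[OF subgroup.mem_carrier[OF S(1)] subgroup_axioms] by blast
  interpret UU: group "G\<lparr>carrier := ?U\<rparr>" by (rule subgroup.subgroup_is_group[OF sU is_group])
  have "card S dvd card ?U"
    using UU.subgroup_card_dvd_order[OF subgroup_incl[OF S(1) sU SU]] by (simp add: Coset.order_def)
  then have vU: "p ^ v * p dvd card H * p ^ c * p" using S(3) cU c(2) by (intro mult_dvd_mono) simp_all
  have "c = a"
  proof (rule ccontr)
    assume "c \<noteq> a"
    then have "p ^ Suc c dvd p ^ a" using c(1) by (intro le_imp_power_dvd) simp
    then have "card H * p ^ Suc c dvd card H * p ^ a" by (intro mult_dvd_mono) simp_all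
    moreover have "card H * p ^ c * p = card H * p ^ Suc c" "p ^ v * p = p ^ Suc v" "card H * p ^ a = card D"
      using D(3) by simp_all
    ultimately have "p ^ Suc v dvd card D" using vU dvd_trans by metis
    then show False using S(4) by simp
  qed
  then show "card ?S = card ?D" using c(2) cD by simp
qed

text \<open>Indices are preserved when a subgroup of the image of \<open>S\<close> is pulled back to \<open>S\<close>; this transports
  maximal subgroups of a Sylow subgroup of a quotient to maximal subgroups of a Sylow subgroup of the
  group.\<close>

lemma (in normal) vimage_rcos_subgroup:
  assumes fin: "finite (carrier G)" and S: "subgroup S G"
    and M: "subgroup M (G Mod H)" "M \<subseteq> (\<lambda>x. H #> x) ` S"
  shows "subgroup {x \<in> S. H #> x \<in> M} G"
    and "card {x \<in> S. H #> x \<in> M} * card ((\<lambda>x. H #> x) ` S) = card M * card S"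
proof -
  let ?S = "G\<lparr>carrier := S\<rparr>"
  interpret Q: group "G Mod H" by (rule factorgroup_is_group)
  have eq: "{x \<in> S. H #> x \<in> M} = S \<inter> \<Union>M"
  proof (rule Set.set_eqI)
    fix x
    show "x \<in> {x \<in> S. H #> x \<in> M} \<longleftrightarrow> x \<in> S \<inter> \<Union>M"
    proof (cases "x \<in> S")
      case True
      then show ?thesis using mem_Union_subgroup_Mod[OF M(1) subgroup.mem_carrier[OF S True]] by simp
    qed simp
  qed
  show "subgroup {x \<in> S. H #> x \<in> M} G"
    unfolding eq by (rule subgroups_Inter_pair[OF S factgroup_subgroup_union_subgroup[OF M(1)]])
  have SS: "group ?S" by (rule subgroup.subgroup_is_group[OF S is_group])
  have finS: "finite (carrier ?S)" using finite_subset[OF subgroup.subset[OF S] fin] by simp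
  interpret h: group_hom ?S "G Mod H" "\<lambda>x. H #> x"
  proof (intro group_hom.intro group_hom_axioms.intro SS Q.is_group homI)
    show "H #> x \<in> carrier (G Mod H)" if "x \<in> carrier ?S" for x
      using that subgroup.mem_carrier[OF S] by (auto simp: carrier_FactGroup)
    show "H #> (x \<otimes>\<^bsub>?S\<^esub> y) = (H #> x) \<otimes>\<^bsub>G Mod H\<^esub> (H #> y)"
      if "x \<in> carrier ?S" "y \<in> carrier ?S" for x y
      using that subgroup.mem_carrier[OF S] by (simp add: rcos_sum)
  qed
  let ?k = "card (kernel ?S (G Mod H) (\<lambda>x. H #> x))"
  have "card {x \<in> S. H #> x \<in> M} = ?k * card M"
    using h.card_vimage_subset[OF finS, of M] M(2) by simp
  moreover have "card {x \<in> S. H #> x \<in> (\<lambda>x. H #> x) ` S} = ?k * card ((\<lambda>x. H #> x) ` S)"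
    using h.card_vimage_subset[OF finS, of "(\<lambda>x. H #> x) ` S"] by simp
  moreover have "{x \<in> S. H #> x \<in> (\<lambda>x. H #> x) ` S} = S" by blast
  ultimately show "card {x \<in> S. H #> x \<in> M} * card ((\<lambda>x. H #> x) ` S) = card M * card S"
    by (simp add: mult_ac)
qed

text \<open>Apply \<open>ex_normal_prime_order_subgroup\<close> to \<open>G/N\<close> and its normal subgroup \<open>D/N\<close>, the normal Sylow
  subgroup of \<open>A/N\<close> for the largest prime divisor \<open>p\<close> of \<open>|A/N|\<close>. A subgroup of index \<open>p\<close> of
  \<open>D/N\<close> is the image of a subgroup of index \<open>p\<close> of a Sylow subgroup \<open>P0\<close> of \<open>A\<close>, so it is
  normalized by the image of \<open>B\<close>.\<close>

lemma (in group) ex_prime_normal_step: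
  assumes fin: "finite (carrier G)" and A: "A \<lhd> G" and B: "B \<subseteq> carrier G" "carrier G = A <#> B"
    and pc: "prime_chief G A"
    and BM: "\<forall>p P M. sylow_subgroup p P (G\<lparr>carrier := A\<rparr>) \<and> subgroup M G \<and> M \<subseteq> P \<and>
      card M * p = card P \<longrightarrow> normalizes G B M"
    and N: "N \<lhd> G" "N \<subset> A"
  obtains N' r where "Factorial_Ring.prime r" "N' \<lhd> G" "N \<subseteq> N'" "N' \<subseteq> A" "card N' = r * card N"
proof -
  interpret A: normal A G by (rule A)
  interpret N: normal N G by (rule N(1))
  let ?A = "G\<lparr>carrier := A\<rparr>"
  interpret AA: group ?A by (rule A.subgroup_is_group[OF is_group])
  have finA: "finite A" using fin A.subset finite_subset by blast
  have cN: "card N > 0" using fin N.finite_imp_card_positive by simp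
  have NA: "subgroup N ?A" "N \<lhd> ?A"
    using subgroup_incl[OF N.subgroup_axioms A.subgroup_axioms] normal_restrict_supergroup[OF A.subgroup_axioms N(1)] N(2)
    by auto
  have pcA: "prime_chief ?A (carrier ?A)"
    using prime_chief_restrict[OF A.subgroup_axioms] pc by simp
  define R where "R = {r. Factorial_Ring.prime r \<and> r * card N dvd card A}"
  have "card N dvd card A" using AA.subgroup_card_dvd_order[OF NA(1)] by (simp add: Coset.order_def)
  then obtain q where q: "card A = card N * q" by blast
  have "q \<noteq> 1" using q N(2) psubset_card_mono[OF finA N(2)] by auto
  moreover have cA: "card A > 0" using finA A.one_closed card_gt_0_iff by blast
  ultimately obtain r0 where "Factorial_Ring.prime r0" "r0 dvd q"
    using prime_factor_nat by blast
  then have "r0 \<in> R" using q by (simp add: R_def mult.commute)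
  then have "R \<noteq> {}" by blast
  have "R \<subseteq> {..card A}"
  proof
    fix r assume "r \<in> R"
    then have "r dvd card A" by (auto simp: R_def dest: dvd_mult_left)
    then show "r \<in> {..card A}" using dvd_imp_le cA by simp
  qed
  then have "finite R" using finite_subset by blast
  then have "Max R \<in> R" "\<forall>r\<in>R. r \<le> Max R" using \<open>R \<noteq> {}\<close> by simp_all
  then obtain p where p: "Factorial_Ring.prime p" "p * card N dvd card A"
    and pmax: "\<And>r. Factorial_Ring.prime r \<Longrightarrow> r * card N dvd card A \<Longrightarrow> r \<le> p"
    by (auto simp: R_def)
  have p1: "p > 1" using p(1) by (rule prime_gt_1_nat)
  define D where "D = {x \<in> A. \<exists>j::nat. x [^] (p ^ j) \<in> N}"
  have "subgroup D ?A \<and> (\<exists>a. card D = p ^ a * card N) \<and> \<not> p * card D dvd card A"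
    using AA.p_elements_mod_subgroup[OF _ pcA p(1) NA(2)] finA pmax
    by (simp add: Coset.order_def D_def flip: nat_pow_consistent)
  then obtain a where D: "subgroup D ?A" "card D = p ^ a * card N" "\<not> p * card D dvd card A" by blast
  have DA: "D \<subseteq> A" by (auto simp: D_def)
  have sD: "subgroup D G" using incl_subgroup[OF A.subgroup_axioms D(1)] .
  have ND: "N \<subseteq> D" using N(2) by (auto simp: D_def intro!: exI[of _ 0])
  have "D \<lhd> G"
    unfolding normal_iff_normalizes normalizes_def
  proof (intro conjI ballI sD)
    fix g x assume g: "g \<in> carrier G" and x: "x \<in> D"
    then obtain j :: nat where j: "x \<in> A" "x [^] (p ^ j) \<in> N" by (auto simp: D_def)
    have "conj_by G g x [^] (p ^ j) \<in> N" "conj_by G g x \<in> A"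
      using N(1) A g j by (simp_all add: normal_iff_normalizes normalizes_def flip: conj_by_nat_pow)
    then show "conj_by G g x \<in> D" by (auto simp: D_def)
  qed
  have a0: "a > 0" using D(2,3) p(2) by (cases a) auto
  let ?Q = "G Mod N"
  let ?\<pi> = "\<lambda>x. N #> x"
  interpret Q: group ?Q by (rule N.factorgroup_is_group)
  have finQ: "finite (carrier ?Q)" using fin by (simp add: carrier_FactGroup)
  have sP: "subgroup (?\<pi> ` D) ?Q" by (rule N.subgroup_image_rcos[OF sD])
  have cP: "card (?\<pi> ` D) = p ^ a"
    using N.card_Union_subgroup_Mod[OF fin sP] N.Union_image_rcos[OF sD ND] D(2) cN by simp
  have nP: "?\<pi> ` D \<lhd> ?Q"
    unfolding Q.normal_iff_normalizes
  proof
    show "normalizes ?Q (carrier ?Q) (?\<pi> ` D)"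
      using \<open>D \<lhd> G\<close> subgroup.mem_carrier[OF sD]
      by (auto simp: normalizes_def carrier_FactGroup N.conj_by_rcos normal_iff_normalizes)
  qed (rule sP)
  interpret S: normal_p_subgroup ?Q p a "?\<pi> ` D"
    by (intro normal_p_subgroup.intro normal_p_subgroup_axioms.intro Q.is_group finQ p(1) nP cP)
  let ?v = "multiplicity p (card A)"
  obtain P0 where P0: "subgroup P0 ?A" "card P0 = p ^ ?v"
    using sylow_thm[OF p(1) AA.is_group, of ?v "card A div p ^ ?v"] finA
    by (auto simp: Coset.order_def multiplicity_dvd)
  have sP0: "subgroup P0 G" using incl_subgroup[OF A.subgroup_axioms P0(1)] .
  have P0A: "P0 \<subseteq> A" using subgroup.subset[OF P0(1)] by simp
  have syl: "sylow_subgroup p P0 ?A"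
    using p(1) P0 by (simp add: sylow_subgroup_def Coset.order_def)
  interpret PP: group "G\<lparr>carrier := P0\<rparr>" by (rule subgroup.subgroup_is_group[OF sP0 is_group])
  have P0D: "P0 \<subseteq> D"
  proof
    fix x assume x: "x \<in> P0"
    have "x [^] (p ^ ?v) = \<one>"
      using PP.pow_order_eq_1[of x] x P0(2) by (simp add: Coset.order_def flip: nat_pow_consistent)
    then have "x [^] (p ^ ?v) \<in> N" using N.one_closed by simp
    then show "x \<in> D" using x P0A unfolding D_def by blast
  qed
  have "card D dvd card A"
    using AA.subgroup_card_dvd_order[OF D(1)] by (simp add: Coset.order_def)
  moreover have "\<not> p ^ Suc ?v dvd card A"
    using multiplicity_geI[where p = p and n = "Suc ?v" and x = "card A"] cA p1 by auto
  ultimately have "\<not> p ^ Suc ?v dvd card D" using dvd_trans by blast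
  then have surj: "?\<pi> ` P0 = ?\<pi> ` D"
    by (rule N.sylow_subgroup_maps_onto[OF fin p(1) sD ND D(2) sP0 P0D P0(2)])
  have "\<exists>L. L \<lhd> ?Q \<and> L \<subseteq> ?\<pi> ` D \<and> Factorial_Ring.prime (card L)"
  proof (rule S.ex_normal_prime_order_subgroup[OF a0, of "?\<pi> ` A" "?\<pi> ` B"])
    show "?\<pi> ` A \<subseteq> carrier ?Q" "?\<pi> ` B \<subseteq> carrier ?Q"
      using A.subset B(1) by (auto simp: carrier_FactGroup)
    show "carrier ?Q = ?\<pi> ` A <#>\<^bsub>?Q\<^esub> ?\<pi> ` B"
      using set_mult_hom[OF N.r_coset_hom_Mod A.subset B(1)] unfolding carrier_FactGroup B(2) .
  next
    fix M b x assume M: "S.index_p M" and b: "b \<in> ?\<pi> ` B" and x: "x \<in> M"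
    have M': "subgroup M ?Q" "M \<subseteq> ?\<pi> ` D" "card M * p = card (?\<pi> ` D)"
      using M by (auto simp: S.index_p_def)
    obtain b0 where b0: "b0 \<in> B" "b = ?\<pi> b0" using b by blast
    have MS: "M \<subseteq> ?\<pi> ` P0" using M'(2) unfolding surj .
    then obtain x0 where x0: "x0 \<in> P0" "x = ?\<pi> x0" using x by blast
    let ?M = "{y \<in> P0. ?\<pi> y \<in> M}"
    have sM: "subgroup ?M G" and "card ?M * card (?\<pi> ` P0) = card M * card P0"
      using N.vimage_rcos_subgroup[OF fin sP0 M'(1) MS] by simp_all
    then have "card M * (card ?M * p) = card M * card P0"
      unfolding surj M'(3)[symmetric] by (simp add: mult_ac)
    moreover have "card M > 0"
      using finite_subset[OF subgroup.subset[OF M'(1)] finQ] subgroup.one_closed[OF M'(1)] card_gt_0_iff by blast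
    ultimately have "card ?M * p = card P0" by simp
    moreover have "?M \<subseteq> P0" by (rule Collect_restrict)
    ultimately have "sylow_subgroup p P0 ?A \<and> subgroup ?M G \<and> ?M \<subseteq> P0 \<and> card ?M * p = card P0"
      by (intro conjI syl sM)
    then have "normalizes G B ?M" by (rule BM[rule_format])
    moreover have "x0 \<in> ?M" using x0 x by simp
    ultimately have "conj_by G b0 x0 \<in> ?M" by (rule normalizesD[OF _ b0(1)])
    then show "conj_by ?Q b x \<in> M"
      using N.conj_by_rcos[OF subsetD[OF B(1) b0(1)] subgroup.mem_carrier[OF sP0 x0(1)]]
        b0(2) x0(2) by simp
  next
    fix W assume W: "subgroup W ?Q" "W \<subseteq> ?\<pi> ` D" "W \<noteq> {\<one>\<^bsub>?Q\<^esub>}" "normalizes ?Q (?\<pi> ` A) W"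
    have pcQ: "prime_chief ?Q (?\<pi> ` A)"
      by (rule N.prime_chief_Mod[OF fin A.subgroup_axioms psubset_imp_subset[OF N(2)] pc])
    have A_carr: "?\<pi> ` A \<subseteq> carrier ?Q" using A.subset by (auto simp: carrier_FactGroup)
    have t: "{\<one>\<^bsub>?Q\<^esub>} \<subset> W" using subgroup.one_closed[OF W(1)] W(3) by blast
    have WA: "W \<subseteq> ?\<pi> ` A" using W(2) DA by blast
    have nt: "normalizes ?Q (?\<pi> ` A) {\<one>\<^bsub>?Q\<^esub>}"
      unfolding normalizes_def using Q.conj_by_one_right subsetD[OF A_carr] by simp
    obtain L r where "Factorial_Ring.prime r" "subgroup L ?Q" "{\<one>\<^bsub>?Q\<^esub>} \<subseteq> L" "L \<subseteq> W"
      "normalizes ?Q (?\<pi> ` A) L" "card L = r * card {\<one>\<^bsub>?Q\<^esub>}"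
      using prime_chiefD[OF pcQ Q.triv_subgroup W(1) t WA nt W(4)] .
    then show "\<exists>L. subgroup L ?Q \<and> L \<subseteq> W \<and> normalizes ?Q (?\<pi> ` A) L \<and> Factorial_Ring.prime (card L)"
      by (intro exI[of _ L]) simp
  qed
  then obtain L where L: "L \<lhd> ?Q" "L \<subseteq> ?\<pi> ` D" "Factorial_Ring.prime (card L)" by blast
  have sL: "subgroup L ?Q" using L(1) by (rule normal_imp_subgroup)
  show thesis
  proof
    show "Factorial_Ring.prime (card L)" by (rule L(3))
    show "\<Union>L \<lhd> G" by (rule N.factgroup_subgroup_union_normal[OF L(1)])
    show "N \<subseteq> \<Union>L" using subgroup.one_closed[OF sL] by auto
    have "\<Union>L \<subseteq> \<Union>(?\<pi> ` D)" using L(2) by blast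
    then show "\<Union>L \<subseteq> A" using N.Union_image_rcos[OF sD ND] DA by simp
    show "card (\<Union>L) = card L * card N" using N.card_Union_subgroup_Mod[OF fin sL] by simp
  qed
qed

section \<open>Building the chain\<close>

text \<open>The chain condition in the definition of \<open>supersoluble\<close>, stopped at \<open>N\<close>.\<close>

definition cyclic_normal_chain :: "('a, 'b) monoid_scheme \<Rightarrow> 'a set \<Rightarrow> bool" where
  "cyclic_normal_chain G N \<longleftrightarrow> (\<exists>(n::nat) f. f 0 = {\<one>\<^bsub>G\<^esub>} \<and> f n = N \<and> (\<forall>i\<le>n. f i \<lhd> G) \<and>
     (\<forall>i<n. f i \<subseteq> f (Suc i) \<and> cyclic_group ((G\<lparr>carrier := f (Suc i)\<rparr>) Mod f i)))"

lemma (in group) cyclic_normal_chain_one: "cyclic_normal_chain G {\<one>}"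
  unfolding cyclic_normal_chain_def using one_is_normal
  by (intro exI[of _ 0] exI[of _ "\<lambda>_. {\<one>}"]) simp

lemma (in group) cyclic_normal_chain_step:
  assumes fin: "finite (carrier G)" and N: "cyclic_normal_chain G N"
    and N': "N' \<lhd> G" "N \<subseteq> N'" and r: "Factorial_Ring.prime r" and card: "card N' = r * card N"
  shows "cyclic_normal_chain G N'"
proof -
  obtain n :: nat and f where f: "f 0 = {\<one>}" "f n = N" "\<forall>i\<le>n. f i \<lhd> G"
    "\<forall>i<n. f i \<subseteq> f (Suc i) \<and> cyclic_group ((G\<lparr>carrier := f (Suc i)\<rparr>) Mod f i)"
    using N unfolding cyclic_normal_chain_def by blast
  have Nn: "N \<lhd> G" using f(2,3) by blast
  have sN': "subgroup N' G" using N'(1) by (rule normal_imp_subgroup)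
  interpret K: group "G\<lparr>carrier := N'\<rparr>" by (rule subgroup.subgroup_is_group[OF sN' is_group])
  interpret NK: normal N "G\<lparr>carrier := N'\<rparr>" by (rule normal_restrict_supergroup[OF sN' Nn N'(2)])
  interpret Q: group "(G\<lparr>carrier := N'\<rparr>) Mod N" by (rule NK.factorgroup_is_group)
  have "finite N'" using fin finite_subset[OF subgroup.subset[OF sN']] by blast
  then have "card N > 0" using NK.finite_imp_card_positive by simp
  then have "Coset.order ((G\<lparr>carrier := N'\<rparr>) Mod N) = r"
    using K.lagrange[OF NK.subgroup_axioms] card by (simp add: Coset.order_def FactGroup_def)
  then have cyc: "cyclic_group ((G\<lparr>carrier := N'\<rparr>) Mod N)" using Q.prime_order_cyclic r by simp
  let ?f = "f(Suc n := N')"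
  show ?thesis
    unfolding cyclic_normal_chain_def
  proof (intro exI[of _ "Suc n"] exI[of _ ?f] conjI allI impI)
    show "?f 0 = {\<one>}" "?f (Suc n) = N'" using f(1) by simp_all
    show "?f i \<lhd> G" if "i \<le> Suc n" for i using that f(3) N'(1) by (auto simp: le_Suc_eq)
    show "?f i \<subseteq> ?f (Suc i)" if "i < Suc n" for i using that f(2,4) N'(2) by (auto simp: less_Suc_eq)
    show "cyclic_group ((G\<lparr>carrier := ?f (Suc i)\<rparr>) Mod ?f i)" if "i < Suc n" for i
      using that f(2,4) cyc by (auto simp: less_Suc_eq)
  qed
qed

lemma (in group) subgroup_set_mult_normal:
  assumes A: "A \<lhd> G" and S: "subgroup S G"
  shows "subgroup (A <#> S) G"
proof -
  interpret A: normal A G by (rule A)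
  have c: "conj_by G s a \<in> A" if "s \<in> carrier G" "a \<in> A" for s a
    using A that by (simp add: normal_iff_normalizes normalizes_def)
  note Sc = subgroup.mem_carrier[OF S]
  show ?thesis
  proof (rule subgroupI)
    show "A <#> S \<subseteq> carrier G" using Sc by (auto simp: set_mult_def)
    have "\<one> \<otimes> \<one> \<in> A <#> S" using subgroup.one_closed[OF S] A.one_closed unfolding set_mult_def by blast
    then show "A <#> S \<noteq> {}" by blast
  next
    fix x assume "x \<in> A <#> S"
    then obtain a s where x: "a \<in> A" "s \<in> S" "x = a \<otimes> s" by (auto simp: set_mult_def)
    have "inv x = conj_by G (inv s) (inv a) \<otimes> inv s"
      using x Sc by (simp add: conj_by_def inv_mult_group m_assoc)
    moreover have "conj_by G (inv s) (inv a) \<in> A" using c x Sc by simp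
    moreover have "inv s \<in> S" using x subgroup.m_inv_closed[OF S] by simp
    ultimately show "inv x \<in> A <#> S" unfolding set_mult_def by blast
  next
    fix x y assume "x \<in> A <#> S" "y \<in> A <#> S"
    then obtain a s a' s' where x: "a \<in> A" "s \<in> S" "x = a \<otimes> s" and y: "a' \<in> A" "s' \<in> S" "y = a' \<otimes> s'"
      by (auto simp: set_mult_def)
    have "x \<otimes> y = (a \<otimes> conj_by G s a') \<otimes> (s \<otimes> s')"
    proof -
      have cc: "a \<in> carrier G" "a' \<in> carrier G" "s \<in> carrier G" "s' \<in> carrier G" using x y Sc by auto
      have "inv s \<otimes> (s \<otimes> s') = s'" using cc by (simp flip: m_assoc)
      then show ?thesis using x y cc by (simp add: conj_by_def m_assoc)
    qed
    moreover have "a \<otimes> conj_by G s a' \<in> A" using c x y Sc by simp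
    moreover have "s \<otimes> s' \<in> S" using x y subgroup.m_closed[OF S] by simp
    ultimately show "x \<otimes> y \<in> A <#> S" unfolding set_mult_def by blast
  qed
qed

lemma (in group) normal_set_mult:
  assumes A: "A \<lhd> G" and B: "subgroup B G" "carrier G = A <#> B"
    and S: "subgroup S G" "S \<subseteq> B" "normalizes G B S"
  shows "A <#> S \<lhd> G"
  unfolding normal_iff_normalizes
proof
  interpret A: normal A G by (rule A)
  interpret AS: subgroup "A <#> S" G by (rule subgroup_set_mult_normal[OF A S(1)])
  note Bc = subgroup.mem_carrier[OF B(1)] and Sc = subgroup.mem_carrier[OF S(1)]
  have c: "conj_by G g a \<in> A" if "g \<in> carrier G" "a \<in> A" for g a
    using A that by (simp add: normal_iff_normalizes normalizes_def)
  have AsubAS: "a \<in> A <#> S" if "a \<in> A" for a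
  proof -
    have "a \<otimes> \<one> \<in> A <#> S" using that subgroup.one_closed[OF S(1)] unfolding set_mult_def by blast
    then show ?thesis using that by simp
  qed
  show "subgroup (A <#> S) G" by (rule AS.subgroup_axioms)
  show "normalizes G (carrier G) (A <#> S)"
    unfolding normalizes_def
  proof (intro ballI)
    fix g x assume g: "g \<in> carrier G" and x: "x \<in> A <#> S"
    obtain a b where ab: "a \<in> A" "b \<in> B" "g = a \<otimes> b" using g B(2) by (auto simp: set_mult_def)
    obtain a' s where x': "a' \<in> A" "s \<in> S" "x = a' \<otimes> s" using x by (auto simp: set_mult_def)
    have "conj_by G b x = conj_by G b a' \<otimes> conj_by G b s"
      using ab x' Bc Sc by (simp add: conj_by_mult_right)
    moreover have "conj_by G b a' \<in> A" "conj_by G b s \<in> S"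
      using c ab x' Bc S(3) by (simp_all add: normalizes_def)
    ultimately have "conj_by G b x \<in> A <#> S" unfolding set_mult_def by blast
    then have "a \<otimes> conj_by G b x \<otimes> inv a \<in> A <#> S" using AsubAS ab(1) by simp
    then show "conj_by G g x \<in> A <#> S"
      using ab x Bc by (simp add: conj_by_mult_left) (simp add: conj_by_def[of G a])
  qed
qed

lemma (in group) index_prime_maximal_subgroup:
  assumes fin: "finite P" and P: "subgroup P G" and M: "subgroup M G" "M \<subseteq> P" "card M * p = card P"
    and p: "Factorial_Ring.prime p"
  shows "maximal_subgroup M (G\<lparr>carrier := P\<rparr>)"
proof -
  have p1: "p > 1" using p by (rule prime_gt_1_nat)
  have MP: "subgroup M (G\<lparr>carrier := P\<rparr>)" by (rule subgroup_incl[OF M(1) P M(2)])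
  have cM: "card M > 0"
    using finite_subset[OF M(2) fin] subgroup.one_closed[OF M(1)] card_gt_0_iff by blast
  have "M \<noteq> P" using M(3) p1 cM by auto
  moreover have "K = M \<or> K = P" if K: "subgroup K (G\<lparr>carrier := P\<rparr>)" "M \<subseteq> K" for K
  proof -
    have KG: "subgroup K G" and KP: "K \<subseteq> P" using K(1) by (simp_all add: subgroup_restrict_iff[OF P])
    interpret PP: group "G\<lparr>carrier := P\<rparr>" by (rule subgroup.subgroup_is_group[OF P is_group])
    interpret KK: group "G\<lparr>carrier := K\<rparr>" by (rule subgroup.subgroup_is_group[OF KG is_group])
    have finK: "finite K" using KP fin finite_subset by blast
    have "card M dvd card K"
      using KK.subgroup_card_dvd_order[OF subgroup_incl[OF M(1) KG K(2)]] by (simp add: Coset.order_def)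
    then obtain k where k: "card K = card M * k" by blast
    have "card K dvd card P" using PP.subgroup_card_dvd_order[OF K(1)] by (simp add: Coset.order_def)
    then have "k dvd p" using k M(3) cM by (metis nat_mult_dvd_cancel1)
    then have "k = 1 \<or> k = p" using p prime_nat_iff by blast
    then show ?thesis
    proof
      assume "k = 1"
      then show ?thesis using card_subset_eq[OF finK K(2)] k by simp
    next
      assume "k = p"
      then show ?thesis using card_subset_eq[OF fin KP] k M(3) by simp
    qed
  qed
  ultimately show ?thesis using MP by (simp add: maximal_subgroup_def)
qed

text \<open>If \<open>b x = m b'\<close>, then \<open>m\<^sup>-\<^sup>1 (b x b\<^sup>-\<^sup>1) = b' b\<^sup>-\<^sup>1\<close>. The left side is in the normal subgroup \<open>A\<close> and
  the right side in \<open>B\<close>, so both are trivial.\<close>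

lemma (in group) permutes_with_normal_complement_imp_normalizes:
  assumes A: "A \<lhd> G" and B: "subgroup B G" "A \<inter> B = {\<one>}" and M: "M \<subseteq> A"
    and perm: "permutes_with G B M" and b: "b \<in> B" and x: "x \<in> M"
  shows "conj_by G b x \<in> M"
proof -
  interpret A: normal A G by (rule A)
  interpret B: subgroup B G by (rule B(1))
  have "b \<otimes> x \<in> B <#> M" using b x unfolding set_mult_def by blast
  then have "b \<otimes> x \<in> M <#> B" using perm by (simp add: permutes_with_def)
  then obtain m b' where m: "m \<in> M" "b' \<in> B" "b \<otimes> x = m \<otimes> b'" by (auto simp: set_mult_def)
  have cc: "b \<in> carrier G" "x \<in> carrier G" "m \<in> carrier G" "b' \<in> carrier G"
    using b x m M by auto
  have e: "inv m \<otimes> conj_by G b x = b' \<otimes> inv b"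
    using m(3) cc m_assoc[of "inv m" m "b' \<otimes> inv b"] by (simp add: conj_by_def m_assoc)
  have "conj_by G b x \<in> A"
    using A cc(1) x M by (auto simp: normal_iff_normalizes normalizes_def)
  then have "inv m \<otimes> conj_by G b x \<in> A" using m(1) M by auto
  moreover have "b' \<otimes> inv b \<in> B" using m(2) b by simp
  ultimately have "inv m \<otimes> conj_by G b x = \<one>" using e B(2) by auto
  then have "conj_by G b x = m" using cc m_assoc[of m "inv m" "conj_by G b x"] by simp
  then show ?thesis using m(1) by simp
qed

text \<open>A largest member of each of two families of subgroups is considered: the subgroups of \<open>A\<close>
  that a cyclic chain of normal subgroups reaches, and the \<open>B\<close>-invariant subgroups \<open>S\<close> of \<open>B\<close> such that
  \<open>A S\<close> is reached. In both cases the largest one is everything, since otherwise it could be enlarged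
  with prime index.\<close>

theorem theoremA:
  fixes G :: "('a, 'b) monoid_scheme" and A B :: "'a set"
  assumes "group G"
    and "finite (carrier G)"
    and "weak_direct_product G A B"
    and "supersoluble (G\<lparr>carrier := A\<rparr>)"
    and "supersoluble (G\<lparr>carrier := B\<rparr>)"
  shows "supersoluble G"
proof -
  interpret group G by (rule assms(1))
  note fin = assms(2)
  have A: "subgroup A G" "A \<lhd> G" and B: "subgroup B G" and AB: "carrier G = A <#>\<^bsub>G\<^esub> B"
    and disj: "A \<inter> B = {\<one>\<^bsub>G\<^esub>}"
    and perm: "\<forall>p P M. sylow_subgroup p P (G\<lparr>carrier := A\<rparr>) \<and> maximal_subgroup M (G\<lparr>carrier := P\<rparr>)
        \<longrightarrow> permutes_with G B M"
    using assms(3) unfolding weak_direct_product_def weak_normal_product_def by simp_all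
  have sub_carrier: "A \<subseteq> carrier G" "B \<subseteq> carrier G" using A(1) B subgroup.subset by auto
  have pc: "prime_chief G C" if C: "subgroup C G" "supersoluble (G\<lparr>carrier := C\<rparr>)" for C
  proof -
    interpret C: group "G\<lparr>carrier := C\<rparr>" by (rule subgroup.subgroup_is_group[OF C(1) assms(1)])
    have "finite (carrier (G\<lparr>carrier := C\<rparr>))"
      using finite_subset[OF subgroup.subset[OF C(1)] fin] by simp
    then show ?thesis
      using C.supersoluble_imp_prime_chief[OF _ C(2)] prime_chief_restrict[OF C(1)] by simp
  qed
  have BM: "\<forall>p P M. sylow_subgroup p P (G\<lparr>carrier := A\<rparr>) \<and> subgroup M G \<and> M \<subseteq> P \<and>
      card M * p = card P \<longrightarrow> normalizes G B M"
  proof (intro allI impI, elim conjE)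
    fix p P M
    assume syl: "sylow_subgroup p P (G\<lparr>carrier := A\<rparr>)" and M: "subgroup M G" "M \<subseteq> P" "card M * p = card P"
    have p: "Factorial_Ring.prime p" and "subgroup P (G\<lparr>carrier := A\<rparr>)"
      using syl by (simp_all add: sylow_subgroup_def)
    then have P: "subgroup P G" "P \<subseteq> A" by (simp_all add: subgroup_restrict_iff[OF A(1)])
    have "finite P" using P(2) sub_carrier(1) fin finite_subset by metis
    then have "maximal_subgroup M (G\<lparr>carrier := P\<rparr>)"
      using index_prime_maximal_subgroup[OF _ P(1) M p] by simp
    then have perm_M: "permutes_with G B M" using perm syl by blast
    have MA: "M \<subseteq> A" using M(2) P(2) by blast
    show "normalizes G B M"
      unfolding normalizes_def
      using permutes_with_normal_complement_imp_normalizes[OF A(2) B disj MA perm_M] by blast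
  qed
  have finP: "finite (Pow (carrier G))" using fin by simp
  have chain_A: "cyclic_normal_chain G A"
  proof -
    define F where "F = {N. N \<lhd> G \<and> N \<subseteq> A \<and> cyclic_normal_chain G N}"
    have "finite F"
      by (rule finite_subset[OF _ finP]) (use sub_carrier in \<open>auto simp: F_def\<close>)
    moreover have "{\<one>\<^bsub>G\<^esub>} \<in> F"
      using one_is_normal cyclic_normal_chain_one subgroup.one_closed[OF A(1)] by (simp add: F_def)
    then have "F \<noteq> {}" by blast
    ultimately have "\<exists>N\<in>F. \<forall>N'\<in>F. N \<subseteq> N' \<longrightarrow> N = N'"
      by (rule finite_has_maximal)
    then obtain N where "N \<in> F" and max: "\<forall>N'\<in>F. N \<subseteq> N' \<longrightarrow> N = N'" by (rule bexE)
    then have N: "N \<lhd> G" "N \<subseteq> A" "cyclic_normal_chain G N" by (simp_all add: F_def)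
    have "N = A"
    proof (rule ccontr)
      assume "N \<noteq> A"
      then have "N \<subset> A" using N(2) by blast
      then obtain N' r where N': "Factorial_Ring.prime r" "N' \<lhd> G" "N \<subseteq> N'" "N' \<subseteq> A" "card N' = r * card N"
        by (rule ex_prime_normal_step[OF fin A(2) sub_carrier(2) AB pc[OF A(1) assms(4)] BM N(1)])
      then have "cyclic_normal_chain G N'"
        using cyclic_normal_chain_step[OF fin N(3)] by blast
      then have "N' \<in> F" using N' by (simp add: F_def)
      then have "N = N'" using max N'(3) by blast
      then have "card N = card N'" by (rule arg_cong)
      moreover have "card N > 0"
        using finite_subset[OF subset_trans[OF N(2) sub_carrier(1)] fin]
          subgroup.one_closed[OF normal_imp_subgroup[OF N(1)]] card_gt_0_iff by blast
      ultimately show False using N'(5) prime_gt_1_nat[OF N'(1)] by simp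
    qed
    then show ?thesis using N(3) by simp
  qed
  have "cyclic_normal_chain G (A <#>\<^bsub>G\<^esub> B)"
  proof -
    define F where "F = {S. subgroup S G \<and> S \<subseteq> B \<and> normalizes G B S \<and> cyclic_normal_chain G (A <#>\<^bsub>G\<^esub> S)}"
    have A1: "A <#>\<^bsub>G\<^esub> {\<one>\<^bsub>G\<^esub>} = A"
      using coset_mult_one[OF sub_carrier(1)] by (simp add: r_coset_eq_set_mult)
    have "finite F"
      by (rule finite_subset[OF _ finP]) (use sub_carrier in \<open>auto simp: F_def\<close>)
    moreover have "{\<one>\<^bsub>G\<^esub>} \<in> F"
      using triv_subgroup chain_A A1 subgroup.one_closed[OF B] sub_carrier(2)
      by (auto simp: F_def normalizes_def)
    then have "F \<noteq> {}" by blast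
    ultimately have "\<exists>S\<in>F. \<forall>S'\<in>F. S \<subseteq> S' \<longrightarrow> S = S'"
      by (rule finite_has_maximal)
    then obtain S where "S \<in> F" and max: "\<forall>S'\<in>F. S \<subseteq> S' \<longrightarrow> S = S'" by (rule bexE)
    then have S: "subgroup S G" "S \<subseteq> B" "normalizes G B S" "cyclic_normal_chain G (A <#>\<^bsub>G\<^esub> S)"
      by (simp_all add: F_def)
    have "S = B"
    proof (rule ccontr)
      assume "S \<noteq> B"
      then have SB: "S \<subset> B" using S(2) by blast
      have nB: "normalizes G B B"
        using subgroup.m_closed[OF B] subgroup.m_inv_closed[OF B] by (simp add: normalizes_def conj_by_def)
      obtain S' r where S': "Factorial_Ring.prime r" "subgroup S' G" "S \<subseteq> S'" "S' \<subseteq> B"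
        "normalizes G B S'" "card S' = r * card S"
        using prime_chiefD[OF pc[OF B assms(5)] S(1) B SB order_refl S(3) nB] .
      have int: "A \<inter> T = {\<one>\<^bsub>G\<^esub>}" if "subgroup T G" "T \<subseteq> B" for T
        using disj that subgroup.one_closed[OF that(1)] subgroup.one_closed[OF A(1)] by blast
      have "card (A <#>\<^bsub>G\<^esub> S') = r * card (A <#>\<^bsub>G\<^esub> S)"
        using card_set_mult_disjoint[OF A(1) S'(2) int[OF S'(2,4)]]
          card_set_mult_disjoint[OF A(1) S(1) int[OF S(1,2)]] S'(6) by simp
      moreover have "A <#>\<^bsub>G\<^esub> S \<subseteq> A <#>\<^bsub>G\<^esub> S'" using S'(3) by (auto simp: set_mult_def)
      ultimately have "cyclic_normal_chain G (A <#>\<^bsub>G\<^esub> S')"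
        using cyclic_normal_chain_step[OF fin S(4) normal_set_mult[OF A(2) B AB S'(2,4,5)]] S'(1) by blast
      then have "S' \<in> F" using S' by (simp add: F_def)
      then have "S = S'" using max S'(3) by blast
      then have "card S = card S'" by (rule arg_cong)
      moreover have "card S > 0"
        using finite_subset[OF subset_trans[OF S(2) sub_carrier(2)] fin]
          subgroup.one_closed[OF S(1)] card_gt_0_iff by blast
      ultimately show False using S'(6) prime_gt_1_nat[OF S'(1)] by simp
    qed
    then show ?thesis using S(4) by simp
  qed
  then show ?thesis
    using assms(1) unfolding AB[symmetric] supersoluble_def cyclic_normal_chain_def by blast
qed

end
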